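(* Let $\vec n=(n^{(1)},\dots,n^{(r)})$ be one of $(5)$, $(3,3)$, $(4,2)$, $(3,2,2)$, $(2,2,2,2)$, let $Y=\prod_{\alpha=1}^r\mathbb P^{n^{(\alpha)}-1}$ (so $X^\natural(\vec n)\subset Y$ is the anticanonical hypersurface of multidegree $\vec n$), and let $X$ be a splitting configuration of $X^\natural(\vec n)$. With the matrices $L_\alpha$, $T_N$, $T_{\mathcal O_X}$ of the context, define recursively $$M_r:=T_{\mathcal O_X},\qquad M_\alpha:=(M_{\alpha+1}L_{\alpha+1})^{n^{(\alpha+1)}}L_{\alpha+1}^{-n^{(\alpha+1)}},\qquad \alpha=r-1,\dots,0.$$ Then the following matrix identities hold: $$M_0\cdot L_1^{n^{(1)}}\cdots L_r^{n^{(r)}}=T_N,$$ i.e. $M_0$ is the window monodromy matrix $T_N\cdot\prod_{\alpha=1}^rL_\alpha^{-n^{(\alpha)}}$ of $X$, and $$(M_\alpha L_\alpha)^{n^{(\alpha)}}=(L_\alpha M_\alpha)^{n^{(\alpha)}},\qquad \alpha=1,\dots,r.$$ Moreover the result holds under any reordering of $n^{(1)},\dots,n^{(r)}$ (with the corresponding relabelling of the factors of $Y$).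
   Context: **Splitting configuration.** A splitting configuration of $X^\natural(\vec n)$ is given by an integer $n\ge1$ and nonzero vectors $\vec n_I=(n_I^{(1)},\dots,n_I^{(r)})\in\mathbb Z_{\ge0}^r$, $I=1,\dots,n+1$, with $\sum_{I}\vec n_I=\vec n$ (a nontrivial multi-partition). $X\subset\mathbb P^n\times Y$ is the Calabi–Yau threefold complete intersection of $n+1$ generic hypersurfaces, the $I$-th of multidegree $(1,\vec n_I)$. **Topological numbers.** Let $H_0=L$ be the hyperplane class of $\mathbb P^n$, and $H_\alpha$ ($\alpha=1,\dots,r$) the hyperplane class of $\mathbb P^{n^{(\alpha)}-1}$. For $\alpha,\beta,\gamma\in\{0,\dots,r\}$ put $c_{\alpha\beta\gamma}=\int_XH_\alpha H_\beta H_\gamma$, $c_\alpha=\frac1{24}\int_Xc_2(X)H_\alpha$, $l_\alpha=\frac16c_{\alpha\alpha\alpha}+2c_\alpha$, $b_{\alpha\beta}=\frac12(c_{\alpha\alpha\beta}-c_{\alpha\beta\beta})$. Let $A_k$ be the $k$-th elementary symmetric polynomial in the classes $\vec n_I(H)=\sum_{\alpha\ge1}n_I^{(\alpha)}H_\alpha$, $I=1,\dots,n+1$, and $$N=\int_Y(A_2^2-A_1A_3).$$ **Matrices.** All matrices are square of size $2r+4$, with rows and columns indexed in block order by $(\mathcal O_X;\ D_0,\dots,D_r;\ \widetilde C_0,\dots,\widetilde C_r;\ P)$. Row indices $\alpha$ and column indices $\beta$ run over $0,\dots,r$ within blocks. For $\mu=1,\dots,r$, $$L_\mu=\begin{pmatrix}1&0&0&0\\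 \delta_{\mu\alpha}&\delta_{\alpha\beta}&0&0\\ c_{\mu\mu\alpha}&c_{\mu\alpha\beta}&\delta_{\alpha\beta}&0\\ 0&b_{\mu\beta}&\delta_{\mu\beta}&1\end{pmatrix},\qquad T_{\mathcal O_X}=\begin{pmatrix}1&-l_\beta&0&-1\\0&\delta_{\alpha\beta}&0&0\\0&0&\delta_{\alpha\beta}&0\\0&0&0&1\end{pmatrix},$$ and $T_N$ is the identity matrix plus the single extra entry $-N$ in row $\widetilde C_0$, column $D_0$. ($L_\mu$ represents the twist by $\mathcal O_X(H_\mu)$, and $T_{\mathcal O_X}$ the spherical twist by $\mathcal O_X$, acting on the classes of $\mathcal O_X,\mathcal O_{D_\alpha},\mathcal O_{C_\alpha}(-1),\mathcal O_P$, where $D_\alpha$ is a divisor of class $H_\alpha$ and $C_\alpha$ are dual curves.) *)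

theory Defs
  imports
    "Jordan_Normal_Form.Gauss_Jordan_Elimination"
    "HOL-Computational_Algebra.Formal_Power_Series"
    "HOL-Library.Poly_Mapping"
    "HOL-Library.Multiset"
begin

section \<open>Splitting configurations\<close>

text \<open>
  Throughout, \<open>ns = [n^(1), ..., n^(r)]\<close>, so that \<open>Y\<close> is the product of the projective spaces
  of dimensions \<open>n^(\<alpha>) - 1\<close>, and \<open>nI I \<alpha>\<close> is the \<open>\<alpha>\<close>-th component of the \<open>I\<close>-th vector of
  the multi-partition. Values of \<open>nI\<close> are only relevant for \<open>1 \<le> I \<le> n + 1\<close> and \<open>1 \<le> \<alpha> \<le> r\<close>.
\<close>

abbreviation n_comp :: "nat list \<Rightarrow> nat \<Rightarrow> nat" where
  "n_comp ns \<alpha> \<equiv> ns ! (\<alpha> - 1)"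

definition splitting_configuration :: "nat list \<Rightarrow> nat \<Rightarrow> (nat \<Rightarrow> nat \<Rightarrow> nat) \<Rightarrow> bool" where
  "splitting_configuration ns n nI \<longleftrightarrow>
     n \<ge> 1 \<and>
     (\<forall>I\<in>{1..n+1}. \<exists>\<alpha>\<in>{1..length ns}. nI I \<alpha> \<noteq> 0) \<and>
     (\<forall>\<alpha>\<in>{1..length ns}. (\<Sum>I=1..n+1. nI I \<alpha>) = n_comp ns \<alpha>)"


section \<open>Intersection numbers\<close>

text \<open>
  Classes on a product of projective spaces are represented by polynomials in the hyperplane
  classes \<open>H\<^sub>0, H\<^sub>1, ...\<close>. The intersection ring of the product over \<open>\<alpha> \<in> S\<close> of the projective
  spaces of dimension \<open>d \<alpha>\<close> is the quotient of the polynomial ring by the \<open>H\<^sub>\<alpha>^(d \<alpha> + 1)\<close>, and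
  the degree map extracts the coefficient of the class of a point, the product of the
  \<open>H\<^sub>\<alpha>^(d \<alpha>)\<close>. No monomial in the ideal contributes to that coefficient, so it can be read off
  from any polynomial representative.
\<close>

type_synonym cls = "(nat \<Rightarrow>\<^sub>0 nat) \<Rightarrow>\<^sub>0 rat"

definition hyp :: "nat \<Rightarrow> cls" where
  "hyp \<alpha> = Poly_Mapping.single (Poly_Mapping.single \<alpha> 1) 1"

definition int_proj_prod :: "nat set \<Rightarrow> (nat \<Rightarrow> nat) \<Rightarrow> cls \<Rightarrow> rat" where
  "int_proj_prod S d \<omega> = Poly_Mapping.lookup \<omega> (\<Sum>\<alpha>\<in>S. Poly_Mapping.single \<alpha> (d \<alpha>))"

definition int_Y :: "nat list \<Rightarrow> cls \<Rightarrow> rat" where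
  "int_Y ns = int_proj_prod {1..length ns} (\<lambda>\<alpha>. n_comp ns \<alpha> - 1)"

context
  fixes ns :: "nat list" and n :: nat and nI :: "nat \<Rightarrow> nat \<Rightarrow> nat"
begin

definition int_ambient :: "cls \<Rightarrow> rat" where
  "int_ambient = int_proj_prod {0..length ns} (\<lambda>\<alpha>. if \<alpha> = 0 then n else n_comp ns \<alpha> - 1)"

definition nH :: "nat \<Rightarrow> cls" where
  "nH I = (\<Sum>\<alpha>=1..length ns. of_nat (nI I \<alpha>) * hyp \<alpha>)"

text \<open>The fundamental class of \<open>X\<close> is the product of the classes of the \<open>n + 1\<close> hypersurfaces.\<close>

definition int_X :: "cls \<Rightarrow> rat" where
  "int_X \<omega> = int_ambient (\<omega> * (\<Prod>I=1..n+1. hyp 0 + nH I))"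

text \<open>
  Total Chern classes are written as power series in an auxiliary variable whose \<open>k\<close>-th
  coefficient is the \<open>k\<close>-th Chern class. The Euler sequences give the one of the ambient tangent
  bundle, and the normal bundle sequence of the complete intersection \<open>X\<close> gives
  \<open>c(T\<^sub>X) = c(T\<^sub>ambient) / c(N\<^sub>X)\<close>, restricted to \<open>X\<close>.
\<close>

definition chern_ambient :: "cls fps" where
  "chern_ambient = (1 + fps_const (hyp 0) * fps_X) ^ (n + 1)
     * (\<Prod>\<alpha>=1..length ns. (1 + fps_const (hyp \<alpha>) * fps_X) ^ n_comp ns \<alpha>)"

definition chern_normal :: "cls fps" where
  "chern_normal = (\<Prod>I=1..n+1. 1 + fps_const (hyp 0 + nH I) * fps_X)"

definition chern_X :: "cls fps" where
  "chern_X = chern_ambient * fps_right_inverse chern_normal 1"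

lemma chern_X_mult_chern_normal: "chern_X * chern_normal = chern_ambient"
proof -
  have prod_nth_0: "fps_nth (\<Prod>i\<in>S. f i) 0 = 1"
    if "\<And>i. fps_nth (f i) 0 = 1" for S :: "nat set" and f :: "nat \<Rightarrow> cls fps"
    using that by (induction S rule: infinite_finite_induct) (auto simp: fps_mult_nth_0)
  have "fps_nth chern_normal 0 = 1"
    unfolding chern_normal_def by (rule prod_nth_0) simp
  then have "chern_normal * fps_right_inverse chern_normal 1 = 1"
    by (intro fps_right_inverse) simp_all
  then show ?thesis
    unfolding chern_X_def by (simp add: mult.assoc mult.commute[of _ chern_normal])
qed

definition c3_num :: "nat \<Rightarrow> nat \<Rightarrow> nat \<Rightarrow> rat" where
  "c3_num \<alpha> \<beta> \<gamma> = int_X (hyp \<alpha> * hyp \<beta> * hyp \<gamma>)"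

definition c_num :: "nat \<Rightarrow> rat" where
  "c_num \<alpha> = 1 / 24 * int_X (fps_nth chern_X 2 * hyp \<alpha>)"

definition l_num :: "nat \<Rightarrow> rat" where
  "l_num \<alpha> = 1 / 6 * c3_num \<alpha> \<alpha> \<alpha> + 2 * c_num \<alpha>"

definition b_num :: "nat \<Rightarrow> nat \<Rightarrow> rat" where
  "b_num \<alpha> \<beta> = 1 / 2 * (c3_num \<alpha> \<alpha> \<beta> - c3_num \<alpha> \<beta> \<beta>)"

definition esym :: "nat \<Rightarrow> cls" where
  "esym k = (\<Sum>S | S \<subseteq> {1..n+1} \<and> card S = k. \<Prod>I\<in>S. nH I)"

definition N_num :: rat where
  "N_num = int_Y ns ((esym 2)\<^sup>2 - esym 1 * esym 3)"

end


section \<open>Matrices\<close>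

datatype label = Lab_O | Lab_D nat | Lab_C nat | Lab_P

definition labels :: "nat \<Rightarrow> label list" where
  "labels r = [Lab_O] @ map Lab_D [0..<r+1] @ map Lab_C [0..<r+1] @ [Lab_P]"

definition block_mat :: "nat \<Rightarrow> (label \<Rightarrow> label \<Rightarrow> rat) \<Rightarrow> rat mat" where
  "block_mat r f = mat (2 * r + 4) (2 * r + 4) (\<lambda>(i, j). f (labels r ! i) (labels r ! j))"

definition delta :: "'a \<Rightarrow> 'a \<Rightarrow> rat" where
  "delta x y = (if x = y then 1 else 0)"

text \<open>\<open>mat_inverse\<close> is an option: it is \<open>None\<close> on singular matrices.\<close>

definition inv_mat :: "rat mat \<Rightarrow> rat mat" where
  "inv_mat B = the (mat_inverse B)"

text \<open>The ordered product \<open>F 1 * ... * F r\<close> of square matrices of size \<open>2 * r + 4\<close>.\<close>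

definition ordered_prod :: "nat \<Rightarrow> (nat \<Rightarrow> rat mat) \<Rightarrow> rat mat" where
  "ordered_prod r F = foldr (\<lambda>\<alpha> B. F \<alpha> * B) [1..<r+1] (1\<^sub>m (2 * r + 4))"

context
  fixes ns :: "nat list" and n :: nat and nI :: "nat \<Rightarrow> nat \<Rightarrow> nat"
begin

fun L_entry :: "nat \<Rightarrow> label \<Rightarrow> label \<Rightarrow> rat" where
  "L_entry \<mu> (Lab_D \<alpha>) Lab_O = delta \<mu> \<alpha>"
| "L_entry \<mu> (Lab_C \<alpha>) Lab_O = c3_num ns n nI \<mu> \<mu> \<alpha>"
| "L_entry \<mu> (Lab_C \<alpha>) (Lab_D \<beta>) = c3_num ns n nI \<mu> \<alpha> \<beta>"
| "L_entry \<mu> Lab_P (Lab_D \<beta>) = b_num ns n nI \<mu> \<beta>"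
| "L_entry \<mu> Lab_P (Lab_C \<beta>) = delta \<mu> \<beta>"
| "L_entry \<mu> x y = delta x y"

definition L_mat :: "nat \<Rightarrow> rat mat" where
  "L_mat \<mu> = block_mat (length ns) (L_entry \<mu>)"

fun T_O_entry :: "label \<Rightarrow> label \<Rightarrow> rat" where
  "T_O_entry Lab_O (Lab_D \<beta>) = - l_num ns n nI \<beta>"
| "T_O_entry Lab_O Lab_P = - 1"
| "T_O_entry x y = delta x y"

definition T_O_mat :: "rat mat" where
  "T_O_mat = block_mat (length ns) T_O_entry"

definition T_N_mat :: "rat mat" where
  "T_N_mat = block_mat (length ns)
     (\<lambda>x y. if x = Lab_C 0 \<and> y = Lab_D 0 then - N_num ns n nI else delta x y)"

function M_mat :: "nat \<Rightarrow> rat mat" where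
  "M_mat \<alpha> = (if \<alpha> \<ge> length ns then T_O_mat
     else (M_mat (\<alpha> + 1) * L_mat (\<alpha> + 1)) ^\<^sub>m n_comp ns (\<alpha> + 1)
          * inv_mat (L_mat (\<alpha> + 1)) ^\<^sub>m n_comp ns (\<alpha> + 1))"
  by pat_completeness auto
termination
  by (relation "measure (\<lambda>\<alpha>. length ns - \<alpha>)") auto

end

declare M_mat.simps [simp del]

end

(*
  Idea. Put P_\<alpha> = M_\<alpha> - 1. If P L^m P = - C(m + k - 1, m) P for 0 < m < k, where k = n^(\<alpha>) and
  L = L_\<alpha>, then (M_\<alpha> L)^k L^(-k) = 1 + sum_{i <= j < k} (-1)^(j - i) C(k, j - i) L^i P L^(-j): the coefficients
  invert the Gram matrix of the Beilinson collection O, ..., O(k - 1). The hypothesis on P reduces to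
  values of the Euler characteristic of line bundles on X, computed by Riemann-Roch.
  Since (L - 1)^k = 0, the sum telescopes under conjugation by L, so it commutes with L; this is the
  second family of identities. Unrolling the recursion writes M_0 - 1 as an explicit sum over the box
  of the Beilinson collection of Y of matrices of rank one, which is then evaluated. The intersection numbers involving H_0
  enter only through the coefficients of A_2 and through the numbers c_{00\<alpha>}, which stay symbolic; l_0
  drops out.
*)
theory Submission
  imports Defs "HOL-Library.Function_Algebras"
begin

section \<open>Endomorphism rings\<close>

text \<open>Why the box sum is a line bundle twist up to one entry: coefficients inverting the Gram
  matrix are those of Beilinson's resolution of the diagonal of Y, so in K-theory M_0 - 1 is minus
  the push-forward along the projection of X to Y followed by pull-back. For an embedded
  anticanonical hypersurface that composition sends E to E - E(-n), with n the vector of the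
  n^(\<alpha>), and M_0 would be the twist by O(-n). Here X maps onto a determinantal hypersurface
  and contracts curves of class C_0 over the points where the matrix of the n + 1 linear equations
  has corank two; A_2^2 - A_1 A_3 counts them, which accounts for the entry -N. The number l_0
  occurs only in column D_0, as a constant in the right-hand shift. Summing the coefficients over
  right-hand shifts leaves the product of the (L_\<alpha> - 1)^(n^(\<alpha>) - 1), of total degree
  dim Y = 4, which vanishes on a threefold. Keeping the coefficients of A_2 symbolic replaces an
  enumeration of all multi-partitions by one family of polynomial identities for each ordered
  list.\<close>

typedef (overloaded) 'a endo = "{f :: ('a::{ab_group_add,zero_neq_one}) \<Rightarrow> 'a. \<forall>x y. f (x + y) = f x + f y}"
  morphisms app Endo
  by (rule exI[of _ "\<lambda>x. x"]) simp

setup_lifting type_definition_endo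

text \<open>Additive maps form a genuine ring, so powers and finite sums carry no size conditions as
  they do for matrices. The sort \<open>zero_neq_one\<close> of the underlying group makes the ring
  nontrivial, as \<open>ring_1\<close> demands.\<close>

instantiation endo :: ("{ab_group_add,zero_neq_one}") ring_1
begin

lift_definition zero_endo :: "'a endo" is "\<lambda>x. 0" by simp
lift_definition one_endo :: "'a endo" is "\<lambda>x. x" by simp
lift_definition plus_endo :: "'a endo \<Rightarrow> 'a endo \<Rightarrow> 'a endo" is "\<lambda>f g x. f x + g x"
  by (simp add: algebra_simps)
lift_definition uminus_endo :: "'a endo \<Rightarrow> 'a endo" is "\<lambda>f x. - f x" by simp
lift_definition minus_endo :: "'a endo \<Rightarrow> 'a endo \<Rightarrow> 'a endo" is "\<lambda>f g x. f x - g x"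
  by (simp add: algebra_simps)
lift_definition times_endo :: "'a endo \<Rightarrow> 'a endo \<Rightarrow> 'a endo" is "\<lambda>f g x. f (g x)" by simp

instance
proof
  show "(0 :: 'a endo) \<noteq> 1"
    by transfer (metis zero_neq_one)
qed (transfer; simp add: algebra_simps fun_eq_iff)+
end

section \<open>Inverse Gram coefficients and ordered products of twists\<close>

definition alt_binom :: "nat \<Rightarrow> nat \<Rightarrow> int" where
  "alt_binom n d = (-1) ^ d * int (n choose d)"

text \<open>This is the coefficient of x^m in (1 - x)^n (1 - x)^(-n) = 1: up to sign the second
  binomial is \<open>- n gchoose (m - d)\<close>, and Vandermonde applies to the exponents n and
  -n.\<close>

lemma sum_alt_binom_mult_binom:
  assumes "n > 0" "m > 0"
  shows "(\<Sum>d\<le>m. alt_binom n d * int ((m - d + n - 1) choose (m - d))) = 0"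
proof -
  have eq: "of_int (int ((k + n - 1) choose k)) = (-1) ^ k * ((- of_nat n :: rat) gchoose k)" for k
  proof -
    have "(- of_nat n :: rat) gchoose k = (-1) ^ k * ((of_nat n + of_nat k - 1) gchoose k)"
      by (rule gbinomial_minus)
    also have "(of_nat n + of_nat k - 1 :: rat) = of_nat (k + n - 1)"
      using assms by (simp add: of_nat_diff)
    also have "\<dots> gchoose k = of_nat ((k + n - 1) choose k)"
      by (simp add: binomial_gbinomial)
    finally show ?thesis
      by (simp flip: mult.assoc power_mult_distrib)
  qed
  have "(\<Sum>d\<le>m. of_int (alt_binom n d * int ((m - d + n - 1) choose (m - d))) :: rat)
      = (\<Sum>d\<le>m. (-1) ^ m * ((of_nat n gchoose d) * ((- of_nat n) gchoose (m - d))))"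
  proof (rule sum.cong)
    fix d assume "d \<in> {..m}"
    then have "(-1 :: rat) ^ d * (-1) ^ (m - d) = (-1) ^ m"
      by (simp flip: power_add)
    then show "(of_int (alt_binom n d * int ((m - d + n - 1) choose (m - d))) :: rat)
        = (-1) ^ m * ((of_nat n gchoose d) * ((- of_nat n) gchoose (m - d)))"
      unfolding of_int_mult eq alt_binom_def
      by (simp add: binomial_gbinomial algebra_simps)
  qed simp
  also have "\<dots> = (-1) ^ m * ((of_nat n + - of_nat n) gchoose m)"
    unfolding gbinomial_Vandermonde[symmetric] sum_distrib_left by (simp add: atLeast0AtMost)
  also have "\<dots> = 0"
    using assms by (simp add: gbinomial_0_left)
  finally show ?thesis
    by (metis (no_types, lifting) of_int_eq_0_iff of_int_sum sum.cong)
qed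

lemma of_int_commute_left: "x * (of_int k * y) = of_int k * (x * (y :: 'a :: ring_1))"
  by (metis mult.assoc mult_of_int_commute)

text \<open>
  If \<open>1 + P\<close> is the composition of the twists by the line bundles \<open>O(k)\<close> of a sub-box of the Beilinson
  box, then adjoining one more projective factor of dimension \<open>n - 1\<close> replaces \<open>P\<close> by
  \<open>box_step n L (inverse of L) P\<close>. The coefficients invert the Gram matrix
  \<open>\<chi>(O(j), O(k))\<close> of the Beilinson collection on that factor.
\<close>

definition box_step :: "nat \<Rightarrow> 'a \<Rightarrow> 'a \<Rightarrow> 'a \<Rightarrow> 'a :: ring_1" where
  "box_step n L L' P = (\<Sum>j<n. \<Sum>k\<le>j. of_int (alt_binom n (j - k)) * (L ^ k * P * L' ^ j))"

lemma inverse_power_mult_power: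
  fixes L L' :: "'a :: monoid_mult"
  assumes "L' * L = 1" "j \<le> s"
  shows "L' ^ j * L ^ s = L ^ (s - j)"
  using assms(2)
proof (induction j arbitrary: s)
  case (Suc j)
  then obtain t where s: "s = Suc t" "j \<le> t"
    by (cases s) auto
  have "L' ^ Suc j * L ^ s = L' ^ j * (L' * L) * L ^ t"
    unfolding s(1) by (subst power_Suc2, subst power_Suc) (simp only: mult.assoc)
  then show ?case
    using Suc.IH s assms(1) by simp
qed simp

text \<open>The left side is the ordered product of the conjugates
  \<open>1 + L ^ i * P * L' ^ i\<close> for i < n. Multiplying two of them produces
  \<open>P * L ^ (s - j) * P\<close>, which collapses to a multiple of \<open>P\<close>, so the
  product stays linear in \<open>P\<close>.\<close>

lemma twist_power_eq:
  fixes L L' P :: "'a :: ring_1"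
  assumes inv: "L * L' = 1" "L' * L = 1"
    and P: "\<And>m. 0 < m \<Longrightarrow> m < n \<Longrightarrow> P * L ^ m * P = - (of_nat ((m + n - 1) choose m) * P)"
  shows "((1 + P) * L) ^ n * L' ^ n = 1 + box_step n L L' P"
proof (cases "n = 0")
  case False
  \<comment> \<open>Only the range of the box grows with \<open>s\<close>; the binomials keep the
    final exponent \<open>n\<close>, for which the relations of \<open>P\<close> are stated.\<close>
  have "s \<le> n \<Longrightarrow> ((1 + P) * L) ^ s * L' ^ s
      = 1 + (\<Sum>j<s. \<Sum>k\<le>j. of_int (alt_binom n (j - k)) * (L ^ k * P * L' ^ j))" for s
  proof (induction s)
    case (Suc s)
    let ?a = "\<lambda>d. of_int (alt_binom n d) :: 'a"
    have LL: "L ^ s * L' ^ s = 1"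
      using inverse_power_mult_power[of L L' s s] inv(1) by simp
    have "((1 + P) * L) ^ Suc s * L' ^ Suc s = ((1 + P) * L) ^ s * (1 + P) * (L * L') * L' ^ s"
      by (subst power_Suc2, subst power_Suc) (simp only: mult.assoc)
    also have "\<dots> = ((1 + P) * L) ^ s * (L' ^ s * L ^ s) * (1 + P) * L' ^ s"
      using inverse_power_mult_power[of L' L s s] inv by simp
    also have "\<dots> = (((1 + P) * L) ^ s * L' ^ s) * (1 + L ^ s * P * L' ^ s)"
      using LL by (simp add: algebra_simps)
    also have "\<dots> = (1 + (\<Sum>j<s. \<Sum>k\<le>j. ?a (j - k) * (L ^ k * P * L' ^ j))) * (1 + L ^ s * P * L' ^ s)"
      using Suc by simp
    also have "\<dots> = 1 + (\<Sum>j<s. \<Sum>k\<le>j. ?a (j - k) * (L ^ k * P * L' ^ j)) + L ^ s * P * L' ^ s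
        + (\<Sum>j<s. \<Sum>k\<le>j. ?a (j - k) * (L ^ k * P * L' ^ j) * (L ^ s * P * L' ^ s))"
      by (simp add: algebra_simps sum_distrib_right)
    also have "(\<Sum>j<s. \<Sum>k\<le>j. ?a (j - k) * (L ^ k * P * L' ^ j) * (L ^ s * P * L' ^ s))
        = (\<Sum>j<s. \<Sum>k\<le>j. - of_int (alt_binom n (j - k) * int ((s - j + n - 1) choose (s - j)))
             * (L ^ k * P * L' ^ s))"
    proof (intro sum.cong refl)
      fix j k assume "j \<in> {..<s}"
      then have j: "j < s" by simp
      have "(L ^ k * P * L' ^ j) * (L ^ s * P * L' ^ s) = L ^ k * (P * (L' ^ j * L ^ s) * P) * L' ^ s"
        by (simp add: mult.assoc)
      also have "\<dots> = L ^ k * (P * L ^ (s - j) * P) * L' ^ s"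
        using j inv by (simp add: inverse_power_mult_power)
      also have "\<dots> = L ^ k * (- (of_nat ((s - j + n - 1) choose (s - j)) * P)) * L' ^ s"
        using j Suc.prems by (subst P) auto
      finally have eq: "(L ^ k * P * L' ^ j) * (L ^ s * P * L' ^ s)
          = - of_int (int ((s - j + n - 1) choose (s - j))) * (L ^ k * P * L' ^ s)"
        by (simp add: mult.assoc) (metis mult.assoc mult_of_nat_commute)
      show "?a (j - k) * (L ^ k * P * L' ^ j) * (L ^ s * P * L' ^ s)
          = - of_int (alt_binom n (j - k) * int ((s - j + n - 1) choose (s - j))) * (L ^ k * P * L' ^ s)"
        unfolding mult.assoc[of "?a (j - k)"] eq by (simp add: mult.assoc)
    qed
    also have "\<dots> = (\<Sum>k<s. \<Sum>j=k..<s. - of_int (alt_binom n (j - k) * int ((s - j + n - 1) choose (s - j)))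
             * (L ^ k * P * L' ^ s))"
      by (subst sum.Sigma, simp, simp, subst sum.Sigma, simp, simp)
        (rule sum.reindex_bij_witness[of _ "\<lambda>(k, j). (j, k)" "\<lambda>(j, k). (k, j)"]; auto)
    also have "\<dots> = (\<Sum>k<s. ?a (s - k) * (L ^ k * P * L' ^ s))"
    proof (rule sum.cong)
      fix k assume "k \<in> {..<s}"
      then have k: "k < s" by simp
      \<comment> \<open>The term d = s - k has second binomial 1. Split off from the vanishing sum,
        it is the new coefficient at \<open>L ^ k * P * L' ^ s\<close>.\<close>
      have "(\<Sum>d\<le>s - k. alt_binom n d * int ((s - k - d + n - 1) choose (s - k - d))) = 0"
        using k False by (intro sum_alt_binom_mult_binom) auto
      moreover have "(\<Sum>d\<le>s - k. alt_binom n d * int ((s - k - d + n - 1) choose (s - k - d)))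
          = alt_binom n (s - k) + (\<Sum>d<s - k. alt_binom n d * int ((s - k - d + n - 1) choose (s - k - d)))"
        by (simp flip: lessThan_Suc_atMost)
      moreover have "(\<Sum>d<s - k. alt_binom n d * int ((s - k - d + n - 1) choose (s - k - d)))
          = (\<Sum>j=k..<s. alt_binom n (j - k) * int ((s - j + n - 1) choose (s - j)))"
        by (rule sum.reindex_bij_witness[of _ "\<lambda>j. j - k" "\<lambda>d. d + k"]) (auto simp: add.commute)
      ultimately have "(\<Sum>j=k..<s. - (alt_binom n (j - k) * int ((s - j + n - 1) choose (s - j))))
          = alt_binom n (s - k)"
        by (simp add: sum_negf)
      then have "(\<Sum>j=k..<s. - of_int (alt_binom n (j - k) * int ((s - j + n - 1) choose (s - j)))) = ?a (s - k)"
        by (metis (no_types, lifting) of_int_minus of_int_sum sum.cong)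
      then show "(\<Sum>j=k..<s. - of_int (alt_binom n (j - k) * int ((s - j + n - 1) choose (s - j)))
             * (L ^ k * P * L' ^ s)) = ?a (s - k) * (L ^ k * P * L' ^ s)"
        by (simp only: sum_distrib_right[symmetric])
    qed simp
    finally show ?case
      by (simp add: algebra_simps flip: lessThan_Suc_atMost) (simp add: alt_binom_def)
  qed simp
  then show ?thesis
    unfolding box_step_def by simp
qed (simp add: box_step_def)

lemma box_step_commute:
  fixes L L' P X :: "'a :: ring_1"
  assumes "X * L = L * X" "X * L' = L' * X" "X * P = P * X"
  shows "X * box_step n L L' P = box_step n L L' P * X"
proof -
  have comm: "X * Y ^ k = Y ^ k * X" if "X * Y = Y * X" for Y k
    using that by (simp add: power_commuting_commutes)
  have "X * (of_int a * (L ^ k * P * L' ^ j)) = of_int a * (L ^ k * P * L' ^ j) * X" for a k j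
  proof -
    have "X * (L ^ k * P * L' ^ j) = L ^ k * P * (X * L' ^ j)"
      using comm[OF assms(1)] assms(3) by (simp flip: mult.assoc) (simp add: mult.assoc)
    also have "\<dots> = L ^ k * P * L' ^ j * X"
      using comm[OF assms(2)] by (simp add: mult.assoc)
    finally show ?thesis
      unfolding of_int_commute_left[of X] by (simp add: mult.assoc)
  qed
  then show ?thesis
    by (simp add: box_step_def sum_distrib_left sum_distrib_right)
qed

text \<open>The difference telescopes, and what remains is the Koszul relation \<open>(L - 1)^n = 0\<close>.\<close>

lemma box_step_commute_self:
  fixes L L' P :: "'a :: ring_1"
  assumes inv: "L * L' = 1" "L' * L = 1"
    and koszul: "(\<Sum>d\<le>n. of_int (alt_binom n d) * L ^ (n - d)) = 0"
  shows "L * box_step n L L' P = box_step n L L' P * L"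
proof -
  let ?a = "\<lambda>d. of_int (alt_binom n d) :: 'a"
  let ?B = "box_step n L L' P"
  \<comment> \<open>Along a fixed difference d = j - k, conjugation by \<open>L\<close> only shifts
    k by one, so each such string telescopes.\<close>
  have B: "?B = (\<Sum>d<n. \<Sum>k<n-d. ?a d * (L ^ k * P * L' ^ (k + d)))"
    unfolding box_step_def
    by (subst sum.Sigma, simp, simp, subst sum.Sigma, simp, simp)
      (rule sum.reindex_bij_witness[of _ "\<lambda>(d, k). (k + d, k)" "\<lambda>(j, k). (j - k, k)"]; auto)
  have "L * ?B * L' = (\<Sum>d<n. \<Sum>k<n-d. ?a d * (L ^ Suc k * P * L' ^ (Suc k + d)))"
    unfolding B sum_distrib_left sum_distrib_right
    unfolding of_int_commute_left[of L] by (intro sum.cong refl) (simp add: mult.assoc power_commutes)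
  then have "L * ?B * L' - ?B = (\<Sum>d<n. ?a d * (\<Sum>k<n-d. L ^ Suc k * P * L' ^ (Suc k + d) - L ^ k * P * L' ^ (k + d)))"
    unfolding B by (simp add: sum_subtractf sum_distrib_left right_diff_distrib)
  also have "\<dots> = (\<Sum>d<n. ?a d * (L ^ (n - d) * P * L' ^ n - P * L' ^ d))"
    by (intro sum.cong refl, subst sum_lessThan_telescope) simp
  also have "\<dots> = (\<Sum>d<n. ?a d * L ^ (n - d)) * P * L' ^ n - P * (\<Sum>d<n. ?a d * L' ^ d)"
    by (simp add: right_diff_distrib sum_subtractf sum_distrib_right sum_distrib_left mult.assoc
        of_int_commute_left[of P])
  also have "(\<Sum>d<n. ?a d * L ^ (n - d)) = - ?a n"
    using koszul by (simp add: eq_neg_iff_add_eq_0 flip: lessThan_Suc_atMost)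
  \<comment> \<open>The right-hand boundary sum is the left-hand one times \<open>L' ^ n\<close>, so
    the same Koszul relation evaluates both and they cancel.\<close>
  also have "(\<Sum>d<n. ?a d * L' ^ d) = (\<Sum>d<n. ?a d * L ^ (n - d)) * L' ^ n"
  proof -
    have "L ^ (n - d) * L' ^ n = L' ^ d" if "d < n" for d
      using inverse_power_mult_power[of L L' "n - d" n] inv that by simp
    then show ?thesis
      unfolding sum_distrib_right by (intro sum.cong refl) (simp add: mult.assoc)
  qed
  also have "(\<Sum>d<n. ?a d * L ^ (n - d)) = - ?a n"
    using koszul by (simp add: eq_neg_iff_add_eq_0 flip: lessThan_Suc_atMost)
  finally have "L * ?B * L' - ?B = 0"
    by (simp add: mult.assoc of_int_commute_left[of P])
  then have "L * ?B * L' * L = ?B * L"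
    by simp
  then show ?thesis
    using inv by (simp add: mult.assoc)
qed

text \<open>A left factor meets only the left powers of \<open>L\<close>, through which it passes to
  reach \<open>P\<close>.\<close>

lemma mult_box_step_eq:
  fixes L L' P X :: "'a :: ring_1"
  assumes "X * L = L * X" "X * P = of_int c * P"
  shows "X * box_step n L L' P = of_int c * box_step n L L' P"
proof -
  have "X * (of_int a * (L ^ k * P * L' ^ j)) = of_int c * (of_int a * (L ^ k * P * L' ^ j))" for a k j
  proof -
    have "X * L ^ k = L ^ k * X"
      using assms(1) by (simp add: power_commuting_commutes)
    then have "X * (L ^ k * P * L' ^ j) = L ^ k * (X * P) * L' ^ j"
      by (simp flip: mult.assoc)
    also have "\<dots> = of_int c * (L ^ k * P * L' ^ j)"
      unfolding assms(2) of_int_commute_left[of "L ^ k"] by (simp add: mult.assoc)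
    finally show ?thesis
      unfolding of_int_commute_left[of X] by (simp add: of_int_commute_left[of "of_int a"])
  qed
  then show ?thesis
    by (simp add: box_step_def sum_distrib_left)
qed

text \<open>Only j = 0 contributes, which forces k = 0 with coefficient 1. The hypothesis is the
  abstract form of the acyclicity of the negative twists O(-j), 0 < j < n.\<close>

lemma box_step_mult_eq:
  fixes L L' P X Q :: "'a :: ring_1"
  assumes "\<And>j. j < n \<Longrightarrow> P * (L' ^ j * X) * Q = (if j = 0 then of_int c * Q else 0)" "n > 0"
  shows "box_step n L L' P * X * Q = of_int c * Q"
proof -
  have "of_int a * (L ^ k * P * L' ^ j) * X * Q = of_int a * (L ^ k * (P * (L' ^ j * X) * Q))" for a k j
    by (simp add: mult.assoc)
  then have "box_step n L L' P * X * Q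
      = (\<Sum>j<n. \<Sum>k\<le>j. of_int (alt_binom n (j - k)) * (L ^ k * (if j = 0 then of_int c * Q else 0)))"
    using assms(1) by (simp add: box_step_def sum_distrib_right)
  also have "\<dots> = (\<Sum>j<n. if j = 0 then of_int c * Q else 0)"
    by (intro sum.cong) (auto simp: alt_binom_def)
  also have "\<dots> = of_int c * Q"
    using assms(2) by simp
  finally show ?thesis .
qed

section \<open>Matrices indexed by labels\<close>

lemma set_labels: "set (labels r) = {Lab_O, Lab_P} \<union> Lab_D ` {..r} \<union> Lab_C ` {..r}"
  by (auto simp: labels_def)

lemma sum_labels:
  "(\<Sum>y\<in>set (labels r). f y) = f Lab_O + (\<Sum>\<alpha>\<le>r. f (Lab_D \<alpha>)) + (\<Sum>\<alpha>\<le>r. f (Lab_C \<alpha>)) + f Lab_P"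
proof -
  have "(\<Sum>y\<in>set (labels r). f y)
      = f Lab_O + (f Lab_P + (sum f (Lab_D ` {..r}) + sum f (Lab_C ` {..r})))"
    unfolding set_labels by (simp add: image_iff) (subst sum.union_disjoint; auto)
  also have "sum f (Lab_D ` {..r}) = (\<Sum>\<alpha>\<le>r. f (Lab_D \<alpha>))"
    by (subst sum.reindex) (auto simp: inj_on_def)
  also have "sum f (Lab_C ` {..r}) = (\<Sum>\<alpha>\<le>r. f (Lab_C \<alpha>))"
    by (subst sum.reindex) (auto simp: inj_on_def)
  finally show ?thesis
    by (simp add: algebra_simps)
qed

lemma distinct_labels: "distinct (labels r)"
  by (auto simp: labels_def distinct_map inj_on_def)

lemma length_labels: "length (labels r) = 2 * r + 4"
  by (simp add: labels_def)

lemma delta_simps [simp]: "delta x x = 1" "x \<noteq> y \<Longrightarrow> delta x y = 0"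
  by (simp_all add: delta_def)

lemma delta_label [simp]:
  "delta (Lab_D a) (Lab_D b) = delta a b" "delta (Lab_C a) (Lab_C b) = delta a b"
  by (simp_all add: delta_def)

lemma delta_mult: "delta a b * x = (if a = b then x else 0)" "x * delta a b = (if a = b then x else 0)"
  by (simp_all add: delta_def)

lemma sum_delta [simp]:
  fixes a r :: nat
  shows "a \<le> r \<Longrightarrow> (\<Sum>b\<le>r. delta a b * f b) = (f a :: rat)"
  "a \<le> r \<Longrightarrow> (\<Sum>b\<le>r. delta b a * f b) = (f a :: rat)"
  "a \<le> r \<Longrightarrow> (\<Sum>b\<le>r. f b * delta a b) = (f a :: rat)"
  "a \<le> r \<Longrightarrow> (\<Sum>b\<le>r. f b * delta b a) = (f a :: rat)"
  by (simp_all add: delta_mult)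

section \<open>Entry functions as operators on label vectors\<close>

definition kernel_mult :: "nat \<Rightarrow> (label \<Rightarrow> label \<Rightarrow> rat) \<Rightarrow> (label \<Rightarrow> label \<Rightarrow> rat) \<Rightarrow> label \<Rightarrow> label \<Rightarrow> rat" where
  "kernel_mult r f g x z = (\<Sum>y\<in>set (labels r). f x y * g y z)"

text \<open>The type \<open>label\<close> has indices of every size, so the operator is cut off
  outside the finitely many labels of a matrix of size 2r + 4.\<close>

lift_definition kernel_op :: "nat \<Rightarrow> (label \<Rightarrow> label \<Rightarrow> rat) \<Rightarrow> (label \<Rightarrow> rat) endo" is
  "\<lambda>r f v x. if x \<in> set (labels r) then \<Sum>y\<in>set (labels r). f x y * v y else 0"
  by (auto simp: fun_eq_iff algebra_simps sum.distrib)

lemma kernel_op_cong: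
  "(\<And>x y. x \<in> set (labels r) \<Longrightarrow> y \<in> set (labels r) \<Longrightarrow> f x y = g x y)
    \<Longrightarrow> kernel_op r f = kernel_op r g"
  by transfer (auto simp: fun_eq_iff intro!: sum.cong)

lemma kernel_op_mult: "kernel_op r f * kernel_op r g = kernel_op r (kernel_mult r f g)"
proof (transfer, intro ext)
  fix r and f g :: "label \<Rightarrow> label \<Rightarrow> rat" and v :: "label \<Rightarrow> rat" and x
  let ?S = "set (labels r)"
  have "(\<Sum>y\<in>?S. f x y * (\<Sum>z\<in>?S. g y z * v z)) = (\<Sum>y\<in>?S. \<Sum>z\<in>?S. f x y * g y z * v z)"
    by (simp add: sum_distrib_left mult.assoc)
  also have "\<dots> = (\<Sum>z\<in>?S. \<Sum>y\<in>?S. f x y * g y z * v z)"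
    by (rule sum.swap)
  also have "\<dots> = (\<Sum>z\<in>?S. kernel_mult r f g x z * v z)"
    by (simp add: kernel_mult_def sum_distrib_right)
  finally show "(if x \<in> ?S then \<Sum>y\<in>?S. f x y * (if y \<in> ?S then \<Sum>z\<in>?S. g y z * v z else 0) else 0)
      = (if x \<in> ?S then \<Sum>z\<in>?S. kernel_mult r f g x z * v z else 0)"
    by simp
qed

lemma kernel_op_add: "kernel_op r f + kernel_op r g = kernel_op r (\<lambda>x y. f x y + g x y)"
  by transfer (auto simp: fun_eq_iff algebra_simps sum.distrib)

lemma kernel_op_zero: "kernel_op r (\<lambda>x y. 0) = 0"
  by transfer (auto simp: fun_eq_iff)

lemma kernel_op_uminus: "- kernel_op r f = kernel_op r (\<lambda>x y. - f x y)"
  by transfer (auto simp: fun_eq_iff sum_negf)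

lemma kernel_op_sum: "(\<Sum>i\<in>I. kernel_op r (f i)) = kernel_op r (\<lambda>x y. \<Sum>i\<in>I. f i x y)"
  by (induction I rule: infinite_finite_induct) (simp_all add: kernel_op_zero kernel_op_add)

lemma kernel_op_of_nat: "of_nat k * kernel_op r f = kernel_op r (\<lambda>x y. of_nat k * f x y)"
  by (induction k) (simp_all add: kernel_op_zero distrib_right kernel_op_add)

lemma kernel_op_of_int: "of_int k * kernel_op r f = kernel_op r (\<lambda>x y. of_int k * f x y)"
proof (cases k rule: int_cases)
  case (nonneg n)
  then show ?thesis
    using kernel_op_of_nat[of n r f] by simp
next
  case (neg n)
  then have "of_int k * kernel_op r f = - (of_nat (Suc n) * kernel_op r f)"
    by (simp only: neg of_int_minus of_int_of_nat_eq mult_minus_left)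
  also have "\<dots> = kernel_op r (\<lambda>x y. of_int k * f x y)"
    unfolding kernel_op_of_nat kernel_op_uminus by (simp add: neg algebra_simps)
  finally show ?thesis .
qed

lemma kernel_op_eqD:
  assumes "kernel_op r f = kernel_op r g" "x \<in> set (labels r)" "y \<in> set (labels r)"
  shows "f x y = g x y"
proof -
  have "app (kernel_op r f) (\<lambda>z. if z = y then 1 else 0) x = f x y" for f
    using assms(2,3) by transfer (simp add: if_distrib cong: if_cong)
  then show ?thesis
    using assms(1) by metis
qed

text \<open>The unital version acts as the identity on the coordinates outside the given labels.\<close>

definition unital_op :: "nat \<Rightarrow> (label \<Rightarrow> label \<Rightarrow> rat) \<Rightarrow> (label \<Rightarrow> rat) endo" where
  "unital_op r f = 1 + kernel_op r (\<lambda>x y. f x y - delta x y)"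

lemma kernel_mult_delta:
  assumes "x \<in> set (labels r)"
  shows "kernel_mult r delta f x z = f x z"
  using assms by (simp add: kernel_mult_def delta_mult)

lemma kernel_mult_delta_right:
  assumes "z \<in> set (labels r)"
  shows "kernel_mult r f delta x z = f x z"
  using assms by (simp add: kernel_mult_def delta_mult)

lemma unital_op_cong:
  "(\<And>x y. x \<in> set (labels r) \<Longrightarrow> y \<in> set (labels r) \<Longrightarrow> f x y = g x y)
    \<Longrightarrow> unital_op r f = unital_op r g"
  unfolding unital_op_def by (intro arg_cong[where f = "\<lambda>t. 1 + t"] kernel_op_cong) simp

lemma kernel_mult_diff:
  "kernel_mult r (\<lambda>x y. f x y - g x y) h x z = kernel_mult r f h x z - kernel_mult r g h x z"
  "kernel_mult r h (\<lambda>x y. f x y - g x y) x z = kernel_mult r h f x z - kernel_mult r h g x z"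
  by (simp_all add: kernel_mult_def algebra_simps sum_subtractf)

lemma unital_op_mult: "unital_op r f * unital_op r g = unital_op r (kernel_mult r f g)"
proof -
  have "unital_op r f * unital_op r g = 1 + kernel_op r (\<lambda>x y. (f x y - delta x y) + (g x y - delta x y)
      + kernel_mult r (\<lambda>x y. f x y - delta x y) (\<lambda>x y. g x y - delta x y) x y)"
    unfolding unital_op_def kernel_op_add[symmetric] kernel_op_mult[symmetric]
    by (simp only: distrib_left distrib_right mult_1_left mult_1_right add.assoc)
  also have "kernel_op r (\<lambda>x y. (f x y - delta x y) + (g x y - delta x y)
      + kernel_mult r (\<lambda>x y. f x y - delta x y) (\<lambda>x y. g x y - delta x y) x y)
      = kernel_op r (\<lambda>x y. kernel_mult r f g x y - delta x y)"
    by (rule kernel_op_cong) (simp add: kernel_mult_diff kernel_mult_delta kernel_mult_delta_right)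
  finally show ?thesis
    by (simp add: unital_op_def)
qed

lemma unital_op_kernel_op: "unital_op r f * kernel_op r g = kernel_op r (kernel_mult r f g)"
proof -
  have "unital_op r f * kernel_op r g = kernel_op r (\<lambda>x y. g x y + kernel_mult r (\<lambda>x y. f x y - delta x y) g x y)"
    unfolding unital_op_def by (simp add: algebra_simps kernel_op_mult flip: kernel_op_add)
  also have "\<dots> = kernel_op r (kernel_mult r f g)"
    by (rule kernel_op_cong) (simp add: kernel_mult_diff kernel_mult_delta)
  finally show ?thesis .
qed

lemma kernel_op_unital_op: "kernel_op r g * unital_op r f = kernel_op r (kernel_mult r g f)"
proof -
  have "kernel_op r g * unital_op r f = kernel_op r (\<lambda>x y. g x y + kernel_mult r g (\<lambda>x y. f x y - delta x y) x y)"
    unfolding unital_op_def by (simp add: algebra_simps kernel_op_mult flip: kernel_op_add)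
  also have "\<dots> = kernel_op r (kernel_mult r g f)"
    by (rule kernel_op_cong) (simp add: kernel_mult_diff kernel_mult_delta_right)
  finally show ?thesis .
qed

lemma unital_op_delta: "unital_op r delta = 1"
  by (simp add: unital_op_def kernel_op_zero)

section \<open>Transfer between block matrices and operators\<close>

lemma block_mat_carrier [simp]: "block_mat r f \<in> carrier_mat (2 * r + 4) (2 * r + 4)"
  by (simp add: block_mat_def)

lemma block_mat_cong:
  assumes "\<And>x y. x \<in> set (labels r) \<Longrightarrow> y \<in> set (labels r) \<Longrightarrow> f x y = g x y"
  shows "block_mat r f = block_mat r g"
  unfolding block_mat_def by (rule cong_mat) (auto intro!: assms nth_mem simp: length_labels)

lemma block_mat_mult: "block_mat r f * block_mat r g = block_mat r (kernel_mult r f g)"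
proof (rule eq_matI)
  fix i j assume "i < dim_row (block_mat r (kernel_mult r f g))" "j < dim_col (block_mat r (kernel_mult r f g))"
  then have ij: "i < 2 * r + 4" "j < 2 * r + 4"
    by (simp_all add: block_mat_def)
  have "(block_mat r f * block_mat r g) $$ (i, j)
      = (\<Sum>k = 0..<2 * r + 4. f (labels r ! i) (labels r ! k) * g (labels r ! k) (labels r ! j))"
    using ij by (simp add: block_mat_def scalar_prod_def)
  also have "\<dots> = kernel_mult r f g (labels r ! i) (labels r ! j)"
    unfolding kernel_mult_def
    by (rule sum.reindex_bij_betw[of "(!) (labels r)" "{0..<2 * r + 4}" "set (labels r)",
          where g = "\<lambda>y. f (labels r ! i) y * g y (labels r ! j)"])
      (simp add: bij_betw_nth distinct_labels length_labels atLeast0LessThan)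
  finally show "(block_mat r f * block_mat r g) $$ (i, j) = block_mat r (kernel_mult r f g) $$ (i, j)"
    using ij by (simp add: block_mat_def)
qed (simp_all add: block_mat_def)

lemma block_mat_delta: "block_mat r delta = 1\<^sub>m (2 * r + 4)"
  by (rule eq_matI)
    (auto simp: block_mat_def delta_def nth_eq_iff_index_eq distinct_labels length_labels)

text \<open>The relation respects products and determines the matrix from the operator, so an
  identity between products of operators becomes one between matrices.\<close>

definition represents :: "nat \<Rightarrow> rat mat \<Rightarrow> (label \<Rightarrow> rat) endo \<Rightarrow> bool" where
  "represents r A E \<longleftrightarrow> (\<exists>f. A = block_mat r f \<and> E = unital_op r f)"

lemma represents_block_mat: "represents r (block_mat r f) (unital_op r f)"
  by (auto simp: represents_def)

lemma represents_carrier: "represents r A E \<Longrightarrow> A \<in> carrier_mat (2 * r + 4) (2 * r + 4)"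
  by (auto simp: represents_def)

lemma represents_mult: "represents r A E \<Longrightarrow> represents r B F \<Longrightarrow> represents r (A * B) (E * F)"
  by (auto simp: represents_def block_mat_mult unital_op_mult)

lemma represents_one: "represents r (1\<^sub>m (2 * r + 4)) 1"
  by (metis represents_def block_mat_delta unital_op_delta)

lemma represents_pow: "represents r A E \<Longrightarrow> represents r (A ^\<^sub>m k) (E ^ k)"
proof (induction k)
  case 0
  then have "dim_row A = 2 * r + 4"
    using represents_carrier by blast
  then show ?case
    using represents_one by simp
next
  case (Suc k)
  then show ?case
    using represents_mult[of r "A ^\<^sub>m k" "E ^ k" A E] by (simp add: power_commutes)
qed

lemma represents_unique:
  assumes "represents r A E" "represents r B E"
  shows "A = B"
proof -
  obtain f g where fg: "A = block_mat r f" "B = block_mat r g" "unital_op r f = unital_op r g"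
    using assms by (auto simp: represents_def)
  then have "kernel_op r (\<lambda>x y. f x y - delta x y) = kernel_op r (\<lambda>x y. g x y - delta x y)"
    by (simp add: unital_op_def)
  then have "f x y = g x y" if "x \<in> set (labels r)" "y \<in> set (labels r)" for x y
    using kernel_op_eqD[OF _ that, of "\<lambda>x y. f x y - delta x y" "\<lambda>x y. g x y - delta x y"] by simp
  then show ?thesis
    using fg block_mat_cong by metis
qed

text \<open>\<open>inv_mat\<close> is \<open>the\<close> of an option, so \<open>mat_inverse\<close>
  must first be shown not to be \<open>None\<close>, by exhibiting \<open>A\<close> as a unit of the
  matrix ring. Uniqueness of inverses then identifies the value with \<open>B\<close>.\<close>

lemma represents_inv_mat:
  assumes "represents r A E" "represents r B F" "E * F = 1" "F * E = 1"
  shows "represents r (inv_mat A) F"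
proof -
  have AB: "A \<in> carrier_mat (2 * r + 4) (2 * r + 4)" "B \<in> carrier_mat (2 * r + 4) (2 * r + 4)"
    using assms represents_carrier by blast+
  have "A * B = 1\<^sub>m (2 * r + 4)"
    using represents_unique[OF represents_mult[OF assms(1,2)]] represents_one assms(3) by simp
  moreover have "B * A = 1\<^sub>m (2 * r + 4)"
    using represents_unique[OF represents_mult[OF assms(2,1)]] represents_one assms(4) by simp
  ultimately have unit: "A \<in> Units (ring_mat TYPE(rat) (2 * r + 4) ())"
    using AB unfolding Units_def ring_mat_def by auto
  then obtain C where C: "mat_inverse A = Some C"
    using mat_inverse(1)[OF AB(1), where b = "()"] by (cases "mat_inverse A") auto
  have inv: "A * C = 1\<^sub>m (2 * r + 4)" "C \<in> carrier_mat (2 * r + 4) (2 * r + 4)" "C * A = 1\<^sub>m (2 * r + 4)"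
    using mat_inverse(2)[OF AB(1) C] by auto
  have "C = C * (A * B)"
    using \<open>A * B = _\<close> inv by simp
  also have "\<dots> = (C * A) * B"
    using assoc_mult_mat[OF inv(2) AB] by simp
  also have "\<dots> = B"
    using inv AB by simp
  finally show ?thesis
    using assms(2) C by (simp add: inv_mat_def)
qed

section \<open>Line bundle twists\<close>

text \<open>
  The matrix of the twist by the line bundle of class \<open>\<Sum>\<^sub>\<alpha> x\<^sub>\<alpha> H\<^sub>\<alpha>\<close>, as a polynomial in \<open>x\<close>. In the Chow ring
  of \<open>X\<close> the basis elements have Chern characters \<open>1\<close>, \<open>1 - exp (- H\<^sub>\<alpha>)\<close>, the curve classes and the point
  class, and the twist is multiplication by \<open>exp (\<Sum>\<^sub>\<alpha> x\<^sub>\<alpha> H\<^sub>\<alpha>)\<close>.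
\<close>

fun line_twist :: "nat \<Rightarrow> (nat \<Rightarrow> nat \<Rightarrow> nat \<Rightarrow> rat) \<Rightarrow> (nat \<Rightarrow> rat) \<Rightarrow> label \<Rightarrow> label \<Rightarrow> rat" where
  "line_twist r c x (Lab_D \<alpha>) Lab_O = x \<alpha>"
| "line_twist r c x (Lab_C \<gamma>) Lab_O =
     ((\<Sum>\<alpha>\<le>r. \<Sum>\<beta>\<le>r. x \<alpha> * x \<beta> * c \<alpha> \<beta> \<gamma>) + (\<Sum>\<alpha>\<le>r. x \<alpha> * c \<alpha> \<alpha> \<gamma>)) / 2"
| "line_twist r c x Lab_P Lab_O =
     ((\<Sum>\<alpha>\<le>r. \<Sum>\<beta>\<le>r. \<Sum>\<gamma>\<le>r. x \<alpha> * x \<beta> * x \<gamma> * c \<alpha> \<beta> \<gamma>) - (\<Sum>\<alpha>\<le>r. x \<alpha> * c \<alpha> \<alpha> \<alpha>)) / 6"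
| "line_twist r c x (Lab_C \<gamma>) (Lab_D \<beta>) = (\<Sum>\<alpha>\<le>r. x \<alpha> * c \<alpha> \<beta> \<gamma>)"
| "line_twist r c x Lab_P (Lab_D \<gamma>) =
     ((\<Sum>\<alpha>\<le>r. \<Sum>\<beta>\<le>r. x \<alpha> * x \<beta> * c \<alpha> \<beta> \<gamma>) - (\<Sum>\<alpha>\<le>r. x \<alpha> * c \<alpha> \<gamma> \<gamma>)) / 2"
| "line_twist r c x Lab_P (Lab_C \<beta>) = x \<beta>"
| "line_twist r c x y z = delta y z"

locale intersection_form =
  fixes r :: nat and c :: "nat \<Rightarrow> nat \<Rightarrow> nat \<Rightarrow> rat"
  assumes c_swap: "c \<alpha> \<beta> \<gamma> = c \<beta> \<alpha> \<gamma>" "c \<alpha> \<beta> \<gamma> = c \<alpha> \<gamma> \<beta>"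
begin

abbreviation quad :: "(nat \<Rightarrow> rat) \<Rightarrow> (nat \<Rightarrow> rat) \<Rightarrow> nat \<Rightarrow> rat" where
  "quad x y \<gamma> \<equiv> \<Sum>\<alpha>\<le>r. \<Sum>\<beta>\<le>r. x \<alpha> * y \<beta> * c \<alpha> \<beta> \<gamma>"

abbreviation cubic :: "(nat \<Rightarrow> rat) \<Rightarrow> (nat \<Rightarrow> rat) \<Rightarrow> (nat \<Rightarrow> rat) \<Rightarrow> rat" where
  "cubic x y z \<equiv> \<Sum>\<alpha>\<le>r. \<Sum>\<beta>\<le>r. \<Sum>\<gamma>\<le>r. x \<alpha> * y \<beta> * z \<gamma> * c \<alpha> \<beta> \<gamma>"

lemma quad_commute: "quad x y \<gamma> = quad y x \<gamma>"
  by (subst sum.swap) (simp add: c_swap mult_ac)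

lemma cubic_swap: "cubic x y z = cubic y x z" "cubic x y z = cubic x z y"
proof -
  show "cubic x y z = cubic y x z"
    by (subst sum.swap) (simp add: c_swap mult_ac)
  have "(\<Sum>\<beta>\<le>r. \<Sum>\<gamma>\<le>r. x \<alpha> * y \<beta> * z \<gamma> * c \<alpha> \<beta> \<gamma>)
      = (\<Sum>\<beta>\<le>r. \<Sum>\<gamma>\<le>r. x \<alpha> * z \<beta> * y \<gamma> * c \<alpha> \<beta> \<gamma>)" for \<alpha>
    by (subst sum.swap) (simp add: c_swap mult_ac)
  then show "cubic x y z = cubic x z y"
    by simp
qed

lemma quad_add: "quad (x + y) (x + y) \<gamma> = quad x x \<gamma> + 2 * quad x y \<gamma> + quad y y \<gamma>"
proof -
  have "quad (x + y) (x + y) \<gamma> = quad x x \<gamma> + quad x y \<gamma> + (quad y x \<gamma> + quad y y \<gamma>)"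
    by (simp add: algebra_simps sum.distrib)
  then show ?thesis
    using quad_commute[of y x] by simp
qed

lemma cubic_add:
  "cubic (x + y) (x + y) (x + y) = cubic x x x + 3 * cubic x x y + 3 * cubic x y y + cubic y y y"
proof -
  have "cubic (x + y) (x + y) (x + y) = cubic x x x + cubic x x y + cubic x y x + cubic x y y
      + cubic y x x + cubic y x y + cubic y y x + cubic y y y"
    by (simp add: algebra_simps sum.distrib)
  moreover have "cubic x y x = cubic x x y" "cubic y x x = cubic x x y" "cubic y x y = cubic x y y"
    "cubic y y x = cubic x y y"
    by (metis cubic_swap)+
  ultimately show ?thesis
    by simp
qed

lemma kernel_mult_labels:
  "kernel_mult r f g x z = f x Lab_O * g Lab_O z + (\<Sum>\<alpha>\<le>r. f x (Lab_D \<alpha>) * g (Lab_D \<alpha>) z)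
     + (\<Sum>\<alpha>\<le>r. f x (Lab_C \<alpha>) * g (Lab_C \<alpha>) z) + f x Lab_P * g Lab_P z"
  by (simp add: kernel_mult_def sum_labels)

text \<open>This is exp(x) exp(x') = exp(x + x') written in the basis of sheaf classes. Only the
  entries reaching from degree 0 to 2 or 3 and from 1 to 3 require the symmetry of the cubic
  form.\<close>

lemma line_twist_add:
  assumes "y \<in> set (labels r)" "z \<in> set (labels r)"
  shows "kernel_mult r (line_twist r c x) (line_twist r c x') y z = line_twist r c (x + x') y z"
proof -
  have lin: "(\<Sum>\<alpha>\<le>r. (x + x') \<alpha> * f \<alpha>) = (\<Sum>\<alpha>\<le>r. x \<alpha> * f \<alpha>) + (\<Sum>\<alpha>\<le>r. x' \<alpha> * f \<alpha>)" for f
    by (simp add: distrib_right sum.distrib)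
  have quad_left: "(\<Sum>\<beta>\<le>r. (\<Sum>\<alpha>\<le>r. x \<alpha> * c \<alpha> \<beta> \<gamma>) * x' \<beta>) = quad x x' \<gamma>" for \<gamma>
    unfolding sum_distrib_right by (subst sum.swap) (simp add: mult_ac)
  have quad_right: "(\<Sum>\<beta>\<le>r. x \<beta> * (\<Sum>\<alpha>\<le>r. x' \<alpha> * c \<alpha> \<gamma> \<beta>)) = quad x x' \<gamma>" for \<gamma>
    unfolding sum_distrib_left by (subst quad_commute, subst sum.swap) (simp add: mult_ac c_swap)
  \<comment> \<open>Passing from O to P through D and through C gives corrections with opposite
    signs, coming from the tails of 1 - exp(-H); by this symmetry they cancel.\<close>
  have diag: "(\<Sum>\<beta>\<le>r. (\<Sum>\<alpha>\<le>r. x \<alpha> * c \<alpha> \<beta> \<beta>) * x' \<beta>) = (\<Sum>\<gamma>\<le>r. x \<gamma> * (\<Sum>\<alpha>\<le>r. x' \<alpha> * c \<alpha> \<alpha> \<gamma>))"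
    unfolding sum_distrib_right sum_distrib_left
    by (subst sum.swap) (simp add: mult_ac c_swap)
  have cubic_left: "(\<Sum>\<gamma>\<le>r. quad x x \<gamma> * x' \<gamma>) = cubic x x x'"
  proof -
    have "(\<Sum>\<gamma>\<le>r. quad x x \<gamma> * x' \<gamma>) = (\<Sum>\<gamma>\<le>r. \<Sum>\<alpha>\<le>r. \<Sum>\<beta>\<le>r. x' \<gamma> * x \<alpha> * x \<beta> * c \<gamma> \<alpha> \<beta>)"
      unfolding sum_distrib_right by (intro sum.cong refl) (simp add: mult_ac c_swap)
    then show ?thesis
      by (metis cubic_swap)
  qed
  have cubic_right: "(\<Sum>\<gamma>\<le>r. x \<gamma> * quad x' x' \<gamma>) = cubic x x' x'"
    unfolding sum_distrib_left by (intro sum.cong refl) (simp add: mult_ac c_swap)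
  consider "y = Lab_O" | a where "y = Lab_D a" "a \<le> r" | a where "y = Lab_C a" "a \<le> r" | "y = Lab_P"
    using assms(1) by (auto simp: set_labels)
  then show ?thesis
  proof cases
    case 1
    then show ?thesis
      by (cases z) (simp_all add: kernel_mult_labels)
  next
    case 2
    then show ?thesis
      using assms(2) by (cases z) (auto simp: kernel_mult_labels set_labels)
  next
    case 3
    have "kernel_mult r (line_twist r c x) (line_twist r c x') y Lab_O = line_twist r c (x + x') y Lab_O"
      using 3(2) unfolding 3(1) kernel_mult_labels line_twist.simps delta_label sum_delta(1)[OF 3(2)] quad_left[of a] quad_add lin
      by (simp add: add_divide_distrib)
    then show ?thesis
      using assms(2) 3 by (cases z) (auto simp: kernel_mult_labels set_labels distrib_right sum.distrib)
  next
    case 4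
    have "kernel_mult r (line_twist r c x) (line_twist r c x') y Lab_O = line_twist r c (x + x') y Lab_O"
    proof -
      have left: "(\<Sum>\<beta>\<le>r. (quad x x \<beta> - (\<Sum>\<alpha>\<le>r. x \<alpha> * c \<alpha> \<beta> \<beta>)) / 2 * x' \<beta>)
          = (cubic x x x' - (\<Sum>\<beta>\<le>r. (\<Sum>\<alpha>\<le>r. x \<alpha> * c \<alpha> \<beta> \<beta>) * x' \<beta>)) / 2"
        unfolding cubic_left[symmetric] by (simp add: left_diff_distrib sum_subtractf flip: sum_divide_distrib)
      have right: "(\<Sum>\<gamma>\<le>r. x \<gamma> * ((quad x' x' \<gamma> + (\<Sum>\<alpha>\<le>r. x' \<alpha> * c \<alpha> \<alpha> \<gamma>)) / 2))
          = (cubic x x' x' + (\<Sum>\<gamma>\<le>r. x \<gamma> * (\<Sum>\<alpha>\<le>r. x' \<alpha> * c \<alpha> \<alpha> \<gamma>))) / 2"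
        unfolding cubic_right[symmetric] by (simp add: distrib_left sum.distrib flip: sum_divide_distrib)
      show ?thesis
        unfolding 4 kernel_mult_labels line_twist.simps left right cubic_add lin diag
        by (simp add: add_divide_distrib diff_divide_distrib)
    qed
    moreover have "kernel_mult r (line_twist r c x) (line_twist r c x') y (Lab_D \<gamma>)
        = line_twist r c (x + x') y (Lab_D \<gamma>)" if "\<gamma> \<le> r" for \<gamma>
      unfolding 4 kernel_mult_labels line_twist.simps delta_label sum_delta(4)[OF that] quad_right quad_add lin
      by (simp add: add_divide_distrib diff_divide_distrib)
    ultimately show ?thesis
      using assms(2) 4 by (cases z) (auto simp: kernel_mult_labels set_labels)
  qed
qed

abbreviation twist_op :: "(nat \<Rightarrow> rat) \<Rightarrow> (label \<Rightarrow> rat) endo" where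
  "twist_op x \<equiv> unital_op r (line_twist r c x)"

lemma twist_op_add: "twist_op x * twist_op y = twist_op (x + y)"
  unfolding unital_op_mult by (rule unital_op_cong) (rule line_twist_add)

lemma twist_op_zero: "twist_op 0 = 1"
  unfolding unital_op_delta[of r, symmetric]
proof (rule unital_op_cong)
  fix x y
  show "line_twist r c 0 x y = delta x y"
    by (cases x; cases y) (simp_all add: delta_def)
qed

lemma twist_op_pow: "twist_op x ^ k = twist_op (\<lambda>i. of_nat k * x i)"
proof (induction k)
  case 0
  then show ?case
    using twist_op_zero by (simp add: zero_fun_def)
next
  case (Suc k)
  have "x + (\<lambda>i. of_nat k * x i) = (\<lambda>i. of_nat (Suc k) * x i)"
    by (auto simp: algebra_simps)
  then show ?case
    using Suc by (simp add: twist_op_add)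
qed

end

section \<open>Twists along a single hyperplane class\<close>

definition single_class :: "nat \<Rightarrow> rat \<Rightarrow> nat \<Rightarrow> rat" where
  "single_class \<alpha> t = (\<lambda>i. if i = \<alpha> then t else 0)"

lemma single_class_add: "single_class \<alpha> s + single_class \<alpha> t = single_class \<alpha> (s + t)"
  by (auto simp: single_class_def)

lemma single_class_zero: "single_class \<alpha> 0 = 0"
  by (auto simp: single_class_def)

lemma single_class_add_left: "single_class \<alpha> t + x = x(\<alpha> := x \<alpha> + t)"
  by (auto simp: single_class_def)

lemma single_class_add_right: "x + single_class \<alpha> t = x(\<alpha> := x \<alpha> + t)"
  by (auto simp: single_class_def)

lemma line_twist_single:
  assumes "\<mu> \<le> r"
  shows "line_twist r c (single_class \<mu> t) (Lab_D \<alpha>) Lab_O = t * delta \<mu> \<alpha>"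
    "line_twist r c (single_class \<mu> t) (Lab_C \<gamma>) Lab_O = (t\<^sup>2 + t) / 2 * c \<mu> \<mu> \<gamma>"
    "line_twist r c (single_class \<mu> t) Lab_P Lab_O = (t ^ 3 - t) / 6 * c \<mu> \<mu> \<mu>"
    "line_twist r c (single_class \<mu> t) (Lab_C \<gamma>) (Lab_D \<beta>) = t * c \<mu> \<beta> \<gamma>"
    "line_twist r c (single_class \<mu> t) Lab_P (Lab_D \<gamma>) = (t\<^sup>2 * c \<mu> \<mu> \<gamma> - t * c \<mu> \<gamma> \<gamma>) / 2"
    "line_twist r c (single_class \<mu> t) Lab_P (Lab_C \<beta>) = t * delta \<mu> \<beta>"
proof -
  have eq: "single_class \<mu> t \<alpha> * y = (if \<alpha> = \<mu> then t * y else 0)" for \<alpha> y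
    by (simp add: single_class_def)
  have sum: "(\<Sum>\<alpha>\<le>r. single_class \<mu> t \<alpha> * f \<alpha>) = t * f \<mu>" for f
    unfolding eq using assms by simp
  have sum2: "(\<Sum>\<alpha>\<le>r. \<Sum>\<beta>\<le>r. single_class \<mu> t \<alpha> * (single_class \<mu> t \<beta> * f \<alpha> \<beta>)) = t * (t * f \<mu> \<mu>)" for f
    by (simp add: sum flip: sum_distrib_left)
  have sum3: "(\<Sum>\<alpha>\<le>r. \<Sum>\<beta>\<le>r. \<Sum>\<gamma>\<le>r. single_class \<mu> t \<alpha> * (single_class \<mu> t \<beta> * (single_class \<mu> t \<gamma> * f \<alpha> \<beta> \<gamma>)))
      = t * (t * (t * f \<mu> \<mu> \<mu>))" for f
    by (simp add: sum flip: sum_distrib_left)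
  show "line_twist r c (single_class \<mu> t) (Lab_D \<alpha>) Lab_O = t * delta \<mu> \<alpha>"
    "line_twist r c (single_class \<mu> t) (Lab_C \<gamma>) Lab_O = (t\<^sup>2 + t) / 2 * c \<mu> \<mu> \<gamma>"
    "line_twist r c (single_class \<mu> t) Lab_P Lab_O = (t ^ 3 - t) / 6 * c \<mu> \<mu> \<mu>"
    "line_twist r c (single_class \<mu> t) (Lab_C \<gamma>) (Lab_D \<beta>) = t * c \<mu> \<beta> \<gamma>"
    "line_twist r c (single_class \<mu> t) Lab_P (Lab_D \<gamma>) = (t\<^sup>2 * c \<mu> \<mu> \<gamma> - t * c \<mu> \<gamma> \<gamma>) / 2"
    "line_twist r c (single_class \<mu> t) Lab_P (Lab_C \<beta>) = t * delta \<mu> \<beta>"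
    unfolding line_twist.simps mult.assoc sum sum2 sum3
    by (simp_all add: single_class_def delta_def algebra_simps power2_eq_square power3_eq_cube)
qed

text \<open>
  The functional \<open>- \<chi>(O\<^sub>X, -)\<close> in the first row of the spherical twist, and its composition with the
  twist by the line bundle of class \<open>w\<close>.
\<close>

fun euler_row :: "(nat \<Rightarrow> rat) \<Rightarrow> label \<Rightarrow> rat" where
  "euler_row l Lab_O = 0"
| "euler_row l (Lab_D \<beta>) = - l \<beta>"
| "euler_row l (Lab_C \<beta>) = 0"
| "euler_row l Lab_P = - 1"

section \<open>The rank-one part of the spherical twist and its box towers\<close>

locale spherical_twist = intersection_form +
  fixes l :: "nat \<Rightarrow> rat"
begin

definition euler_twist :: "(nat \<Rightarrow> rat) \<Rightarrow> label \<Rightarrow> rat" where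
  "euler_twist w y = (\<Sum>z\<in>set (labels r). euler_row l z * line_twist r c w z y)"

text \<open>With l_\<alpha> = c_{\<alpha>\<alpha>\<alpha>}/6 + 2 c_\<alpha> the first value is
  -(w^3/6 + c_2 w/12), that is -\<chi>(O(w)) by Riemann-Roch: the diagonal cubic terms of
  \<open>line_twist\<close> cancel those in l_\<alpha>.\<close>

lemma euler_twist_simps:
  "euler_twist w Lab_O = - (\<Sum>\<alpha>\<le>r. l \<alpha> * w \<alpha>) - line_twist r c w Lab_P Lab_O"
  "\<beta> \<le> r \<Longrightarrow> euler_twist w (Lab_D \<beta>) = - l \<beta> - line_twist r c w Lab_P (Lab_D \<beta>)"
  "euler_twist w (Lab_C \<beta>) = - w \<beta>"
  "euler_twist w Lab_P = - 1"
  by (simp_all add: euler_twist_def sum_labels sum_negf diff_divide_distrib)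

definition sph :: "(label \<Rightarrow> rat) endo" where
  "sph = kernel_op r (\<lambda>x y. delta x Lab_O * euler_row l y)"

lemma twist_sph_twist:
  "twist_op u * sph * twist_op w = kernel_op r (\<lambda>x y. line_twist r c u x Lab_O * euler_twist w y)"
  unfolding sph_def unital_op_kernel_op kernel_op_unital_op
proof (rule kernel_op_cong)
  fix x y
  have "kernel_mult r (line_twist r c u) (\<lambda>x y. delta x Lab_O * euler_row l y) x z
      = line_twist r c u x Lab_O * euler_row l z" for z
    by (simp add: kernel_mult_labels)
  then show "kernel_mult r (kernel_mult r (line_twist r c u) (\<lambda>x y. delta x Lab_O * euler_row l y)) (line_twist r c w) x y
      = line_twist r c u x Lab_O * euler_twist w y"
    by (simp add: kernel_mult_def[of r _ "line_twist r c w"] euler_twist_def sum_distrib_left mult.assoc)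
qed

text \<open>\<open>sph\<close> has rank one with image spanned by the class of O_X, so only the
  Euler characteristic of the line bundle in between survives.\<close>

lemma sph_twist_sph:
  assumes "euler_twist w Lab_O = of_int k"
  shows "sph * twist_op w * sph = of_int k * sph"
proof -
  have "sph * twist_op w * sph = (twist_op 0 * sph * twist_op w) * sph"
    by (simp add: twist_op_zero)
  also have "\<dots> = kernel_op r (\<lambda>x y. delta x Lab_O * (of_int k * euler_row l y))"
  proof -
    have eq: "line_twist r c 0 x Lab_O = delta x Lab_O" for x
      by (cases x) (simp_all add: delta_def)
    show ?thesis
      unfolding twist_sph_twist unfolding sph_def kernel_op_mult eq
      by (intro kernel_op_cong) (simp add: kernel_mult_labels assms)
  qed
  also have "\<dots> = of_int k * sph"
    unfolding sph_def kernel_op_of_int by (simp add: mult_ac)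
  finally show ?thesis .
qed

text \<open>
  A list \<open>[(n, \<alpha>), ...]\<close> stands for the product of the projective spaces of dimension \<open>n - 1\<close> with hyperplane
  class \<open>H\<^sub>\<alpha>\<close>.
\<close>

primrec tower :: "(nat \<times> nat) list \<Rightarrow> (label \<Rightarrow> rat) endo" where
  "tower [] = sph"
| "tower (z # zs) = (case z of (n, \<alpha>) \<Rightarrow>
     box_step n (twist_op (single_class \<alpha> 1)) (twist_op (single_class \<alpha> (- 1))) (tower zs))"

text \<open>Carrying both shifts closes the recursion: left twists accumulate in \<open>u\<close>,
  inverse right twists in \<open>w\<close>, and each leaf is a rank-one kernel.\<close>

primrec box_kernel :: "(nat \<times> nat) list \<Rightarrow> (nat \<Rightarrow> rat) \<Rightarrow> (nat \<Rightarrow> rat) \<Rightarrow> label \<Rightarrow> label \<Rightarrow> rat" where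
  "box_kernel [] u w x y = line_twist r c u x Lab_O * euler_twist w y"
| "box_kernel (z # zs) u w x y = (case z of (n, \<alpha>) \<Rightarrow> \<Sum>j<n. \<Sum>k\<le>j. of_int (alt_binom n (j - k)) *
     box_kernel zs (u(\<alpha> := u \<alpha> + of_nat k)) (w(\<alpha> := w \<alpha> - of_nat j)) x y)"

lemma single_class_pow: "twist_op (single_class \<alpha> t) ^ k = twist_op (single_class \<alpha> (of_nat k * t))"
proof -
  have "(\<lambda>i. of_nat k * single_class \<alpha> t i) = single_class \<alpha> (of_nat k * t)"
    by (auto simp: single_class_def)
  then show ?thesis
    by (simp add: twist_op_pow)
qed

lemma twist_op_commute: "twist_op x * twist_op y = twist_op y * twist_op x"
  by (simp add: twist_op_add add.commute)

lemma twist_op_inverse: "twist_op (single_class \<alpha> t) * twist_op (single_class \<alpha> (- t)) = 1"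
  "twist_op (single_class \<alpha> (- t)) * twist_op (single_class \<alpha> t) = 1"
  by (simp_all add: twist_op_add single_class_add single_class_zero twist_op_zero)

lemma twist_tower_twist: "twist_op u * tower zs * twist_op w = kernel_op r (box_kernel zs u w)"
proof (induction zs arbitrary: u w)
  case Nil
  show ?case
    by (simp only: tower.simps twist_sph_twist box_kernel.simps)
next
  case (Cons z zs)
  obtain n \<alpha> where z: "z = (n, \<alpha>)"
    by (cases z)
  have "twist_op u * (of_int a * (twist_op (single_class \<alpha> 1) ^ k * tower zs * twist_op (single_class \<alpha> (- 1)) ^ j)) * twist_op w
     = of_int a * kernel_op r (box_kernel zs (u(\<alpha> := u \<alpha> + of_nat k)) (w(\<alpha> := w \<alpha> - of_nat j)))" for a j k
  proof -
    have "twist_op u * (of_int a * (twist_op (single_class \<alpha> 1) ^ k * tower zs * twist_op (single_class \<alpha> (- 1)) ^ j)) * twist_op w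
      = of_int a * ((twist_op u * twist_op (single_class \<alpha> (of_nat k))) * tower zs
          * (twist_op (single_class \<alpha> (- of_nat j)) * twist_op w))"
      unfolding of_int_commute_left[of "twist_op u"] by (simp add: single_class_pow mult.assoc)
    then show ?thesis
      unfolding twist_op_add single_class_add_left single_class_add_right Cons.IH by simp
  qed
  then show ?case
    by (simp add: z box_step_def sum_distrib_left sum_distrib_right kernel_op_of_int kernel_op_sum)
qed

text \<open>Numerical acyclicity: -\<chi>(O(x - j)) equals k at the corner j = 0 of the box and
  vanishes at every other box point.\<close>

primrec acyclic_box :: "(nat \<times> nat) list \<Rightarrow> (nat \<Rightarrow> rat) \<Rightarrow> int \<Rightarrow> bool" where
  "acyclic_box [] x k \<longleftrightarrow> euler_twist x Lab_O = of_int k"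
| "acyclic_box (z # zs) x k \<longleftrightarrow> (case z of (n, \<alpha>) \<Rightarrow> n > 0 \<and>
     (\<forall>j<n. acyclic_box zs (x(\<alpha> := x \<alpha> - of_nat j)) (if j = 0 then k else 0)))"

lemma tower_twist_sph:
  "acyclic_box zs x k \<Longrightarrow> tower zs * twist_op x * sph = of_int k * sph"
proof (induction zs arbitrary: x k)
  case Nil
  then show ?case
    by (simp add: sph_twist_sph)
next
  case (Cons z zs)
  obtain n \<alpha> where z: "z = (n, \<alpha>)"
    by (cases z)
  have "tower zs * (twist_op (single_class \<alpha> (- 1)) ^ j * twist_op x) * sph = (if j = 0 then of_int k * sph else 0)"
    if "j < n" for j
  proof -
    have "twist_op (single_class \<alpha> (- 1)) ^ j * twist_op x = twist_op (x(\<alpha> := x \<alpha> - of_nat j))"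
      by (simp add: single_class_pow twist_op_add single_class_add_left)
    moreover have "acyclic_box zs (x(\<alpha> := x \<alpha> - of_nat j)) (if j = 0 then k else 0)"
      using Cons.prems that z by simp
    ultimately show ?thesis
      using Cons.IH by fastforce
  qed
  then show ?case
    unfolding z tower.simps prod.case using Cons.prems z by (intro box_step_mult_eq) auto
qed

text \<open>The expansion of (L_\<alpha> - 1)^n = 0, the K-theory class of the Koszul complex of n
  hyperplanes without common point in a projective space of dimension n - 1.\<close>

definition koszul :: "nat \<Rightarrow> nat \<Rightarrow> bool" where
  "koszul n \<alpha> \<longleftrightarrow> (\<Sum>d\<le>n. of_int (alt_binom n d) * twist_op (single_class \<alpha> 1) ^ (n - d)) = 0"

text \<open>At the factor of its own class the twist commutes by the Koszul relation, whatever lies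
  inside; at any other factor it passes through because line bundle twists commute.\<close>

lemma twist_tower_commute:
  assumes "\<forall>(n, \<alpha>)\<in>set zs. koszul n \<alpha>" "\<beta> \<in> snd ` set zs"
  shows "twist_op (single_class \<beta> 1) * tower zs = tower zs * twist_op (single_class \<beta> 1)"
  using assms
proof (induction zs)
  case (Cons z zs)
  obtain n \<alpha> where z: "z = (n, \<alpha>)"
    by (cases z)
  show ?case
  proof (cases "\<beta> = \<alpha>")
    case True
    then show ?thesis
      using Cons.prems(1) unfolding z tower.simps prod.case koszul_def
      by (auto intro!: box_step_commute_self twist_op_inverse)
  next
    case False
    then show ?thesis
      using Cons z unfolding tower.simps prod.case
      by (auto intro!: box_step_commute twist_op_commute)
  qed
qed simp

lemma mult_tower_eq:
  assumes "X * sph = of_int k * sph"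
    and "\<And>\<alpha>. \<alpha> \<in> snd ` set zs \<Longrightarrow> X * twist_op (single_class \<alpha> 1) = twist_op (single_class \<alpha> 1) * X"
  shows "X * tower zs = of_int k * tower zs"
  using assms
proof (induction zs)
  case (Cons z zs)
  then show ?case
    by (cases z) (auto intro!: mult_box_step_eq)
qed simp

text \<open>
  The Gram matrix of the twisting line bundles is that of the Beilinson collection of the ambient
  projective spaces: the Serre dual contributions vanish on the box.
\<close>

primrec beilinson :: "(nat \<times> nat) list \<Rightarrow> bool" where
  "beilinson [] \<longleftrightarrow> True"
| "beilinson (z # zs) \<longleftrightarrow> (case z of (n, \<alpha>) \<Rightarrow> koszul n \<alpha> \<and>
     (\<forall>m. 0 < m \<longrightarrow> m < n \<longrightarrow> acyclic_box zs (single_class \<alpha> (of_nat m)) (- int ((m + n - 1) choose m)))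
     \<and> beilinson zs)"

lemma beilinson_koszul: "beilinson zs \<Longrightarrow> \<forall>(n, \<alpha>)\<in>set zs. koszul n \<alpha>"
  by (induction zs) auto

text \<open>\<open>twist_power_eq\<close> needs the relation with \<open>tower zs\<close> on both
  sides. Acyclicity gives it with \<open>sph\<close> on the right; since
  \<open>tower zs * L ^ m\<close> commutes with the twists of the inner factors,
  \<open>mult_tower_eq\<close> lifts it to the whole tower.\<close>

lemma twist_power_tower:
  assumes "beilinson ((n, \<alpha>) # zs)"
  shows "((1 + tower zs) * twist_op (single_class \<alpha> 1)) ^ n * twist_op (single_class \<alpha> (- 1)) ^ n
    = 1 + tower ((n, \<alpha>) # zs)"
  unfolding tower.simps prod.case
proof (rule twist_power_eq)
  fix m assume m: "0 < m" "m < n"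
  let ?X = "tower zs * twist_op (single_class \<alpha> (of_nat m))"
  have "?X * tower zs = of_int (- int ((m + n - 1) choose m)) * tower zs"
  proof (rule mult_tower_eq)
    show "?X * sph = of_int (- int ((m + n - 1) choose m)) * sph"
      using assms m by (intro tower_twist_sph) simp
  next
    fix \<beta> assume "\<beta> \<in> snd ` set zs"
    then have "twist_op (single_class \<beta> 1) * tower zs = tower zs * twist_op (single_class \<beta> 1)"
      using assms beilinson_koszul by (intro twist_tower_commute) auto
    then show "?X * twist_op (single_class \<beta> 1) = twist_op (single_class \<beta> 1) * ?X"
      unfolding mult.assoc twist_op_commute[of "single_class \<alpha> (of_nat m)"]
      by (simp only: mult.assoc[symmetric])
  qed
  then show "tower zs * twist_op (single_class \<alpha> 1) ^ m * tower zs = - (of_nat ((m + n - 1) choose m) * tower zs)"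
    by (simp add: single_class_pow)
qed (rule twist_op_inverse)+

text \<open>By \<open>twist_power_tower\<close>, \<open>(M * L) ^ n\<close> is
  \<open>1 + tower\<close> of the longer list times \<open>L ^ n\<close>, hence commutes with
  \<open>L\<close>. Since \<open>L * (M * L) ^ n = (L * M) ^ n * L\<close> in any ring, cancelling
  \<open>L\<close> on the right gives the claim.\<close>

lemma tower_power_commute:
  assumes "beilinson ((n, \<alpha>) # zs)"
  shows "((1 + tower zs) * twist_op (single_class \<alpha> 1)) ^ n = (twist_op (single_class \<alpha> 1) * (1 + tower zs)) ^ n"
proof -
  let ?L = "twist_op (single_class \<alpha> 1)" and ?L' = "twist_op (single_class \<alpha> (- 1))" and ?M = "1 + tower zs"
  have inv: "?L * ?L' = 1" "?L' * ?L = 1"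
    by (rule twist_op_inverse)+
  have comm: "?L * tower ((n, \<alpha>) # zs) = tower ((n, \<alpha>) # zs) * ?L"
    using beilinson_koszul[OF assms] by (intro twist_tower_commute) auto
  have "(?M * ?L) ^ n = (?M * ?L) ^ n * (?L' ^ n * ?L ^ n)"
    using inverse_power_mult_power[OF inv(2), of n n] by simp
  also have "\<dots> = (1 + tower ((n, \<alpha>) # zs)) * ?L ^ n"
    by (simp only: mult.assoc[symmetric] twist_power_tower[OF assms])
  finally have eq: "(?M * ?L) ^ n = (1 + tower ((n, \<alpha>) # zs)) * ?L ^ n" .
  have "?L * (?M * ?L) ^ n = (?M * ?L) ^ n * ?L"
    unfolding eq mult.assoc power_commutes using comm
    by (simp only: mult.assoc[symmetric] distrib_left distrib_right mult_1_left mult_1_right)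
  moreover have "(?L * ?M) ^ k * ?L = ?L * (?M * ?L) ^ k" for k
    by (induction k) (simp_all add: mult.assoc)
  ultimately have "(?M * ?L) ^ n * ?L = (?L * ?M) ^ n * ?L"
    by simp
  then have "(?M * ?L) ^ n * (?L * ?L') = (?L * ?M) ^ n * (?L * ?L')"
    by (simp only: mult.assoc[symmetric])
  then show ?thesis
    using inv by simp
qed

end

section \<open>The recursion for the monodromy matrices\<close>

lemma T_O_entry_eq: "T_O_entry ns n nI x y - delta x y = delta x Lab_O * euler_row (l_num ns n nI) y"
  by (cases x; cases y) (simp_all add: delta_def)

lemma c3_num_swap:
  "c3_num ns n nI \<alpha> \<beta> \<gamma> = c3_num ns n nI \<beta> \<alpha> \<gamma>" "c3_num ns n nI \<alpha> \<beta> \<gamma> = c3_num ns n nI \<alpha> \<gamma> \<beta>"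
  by (simp_all add: c3_num_def mult_ac)

lemma L_entry_eq:
  assumes "x \<in> set (labels r)" "y \<in> set (labels r)" "\<mu> \<le> r"
  shows "L_entry ns n nI \<mu> x y = line_twist r (c3_num ns n nI) (single_class \<mu> 1) x y"
  using assms(3) by (cases x; cases y) (simp_all add: line_twist_single b_num_def delta_def c3_num_swap del: line_twist.simps(1-6))

text \<open>The list starts at \<alpha> + 1, the factor adjoined last, so that M_\<alpha> becomes
  \<open>1 + tower (factors ns \<alpha>)\<close> and M_r corresponds to the empty list.\<close>

definition factors :: "nat list \<Rightarrow> nat \<Rightarrow> (nat \<times> nat) list" where
  "factors ns \<alpha> = map (\<lambda>\<beta>. (n_comp ns \<beta>, \<beta>)) [\<alpha> + 1..<length ns + 1]"

lemma factors_Cons: "\<alpha> < length ns \<Longrightarrow> factors ns \<alpha> = (n_comp ns (\<alpha> + 1), \<alpha> + 1) # factors ns (\<alpha> + 1)"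
  unfolding factors_def by (subst upt_conv_Cons) auto

text \<open>The class -K_Y pulled back to X; its coordinate along H_0 is zero.\<close>

definition anticanonical :: "nat list \<Rightarrow> nat \<Rightarrow> rat" where
  "anticanonical ns \<alpha> = (if \<alpha> \<in> {1..length ns} then of_nat (n_comp ns \<alpha>) else 0)"

locale window =
  fixes ns :: "nat list" and n :: nat and nI :: "nat \<Rightarrow> nat \<Rightarrow> nat"
begin

sublocale spherical_twist "length ns" "c3_num ns n nI" "l_num ns n nI"
  by unfold_locales (rule c3_num_swap)+

lemma represents_L:
  assumes "\<mu> \<le> length ns"
  shows "represents (length ns) (L_mat ns n nI \<mu>) (twist_op (single_class \<mu> 1))"
proof -
  have "L_mat ns n nI \<mu> = block_mat (length ns) (line_twist (length ns) (c3_num ns n nI) (single_class \<mu> 1))"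
    unfolding L_mat_def by (rule block_mat_cong) (simp add: L_entry_eq assms)
  then show ?thesis
    by (simp add: represents_block_mat)
qed

lemma represents_inv_L:
  assumes "\<mu> \<le> length ns"
  shows "represents (length ns) (inv_mat (L_mat ns n nI \<mu>)) (twist_op (single_class \<mu> (- 1)))"
  using represents_inv_mat[OF represents_L[OF assms] represents_block_mat twist_op_inverse] .

lemma represents_T_O: "represents (length ns) (T_O_mat ns n nI) (1 + sph)"
  using represents_block_mat[of "length ns" "T_O_entry ns n nI"]
  by (simp add: T_O_mat_def unital_op_def T_O_entry_eq sph_def)

lemma beilinson_factors:
  assumes "beilinson (factors ns 0)" "\<alpha> \<le> length ns"
  shows "beilinson (factors ns \<alpha>)"
  using assms(2)
proof (induction \<alpha>)
  case (Suc \<alpha>)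
  then show ?case
    using factors_Cons[of \<alpha> ns] by simp
qed (use assms(1) in simp)

lemma represents_M:
  assumes "beilinson (factors ns 0)" "\<alpha> \<le> length ns"
  shows "represents (length ns) (M_mat ns n nI \<alpha>) (1 + tower (factors ns \<alpha>))"
  using assms(2)
proof (induction \<alpha> rule: inc_induct)
  case base
  then show ?case
    using represents_T_O by (subst M_mat.simps) (simp add: factors_def)
next
  case (step \<alpha>)
  then have "represents (length ns) (M_mat ns n nI \<alpha>)
      (((1 + tower (factors ns (\<alpha> + 1))) * twist_op (single_class (\<alpha> + 1) 1)) ^ n_comp ns (\<alpha> + 1)
        * twist_op (single_class (\<alpha> + 1) (- 1)) ^ n_comp ns (\<alpha> + 1))"
    by (subst M_mat.simps)
      (auto intro!: represents_mult represents_pow represents_L represents_inv_L)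
  moreover have "beilinson (factors ns \<alpha>)"
    using beilinson_factors[OF assms(1)] step by simp
  ultimately show ?case
    using twist_power_tower factors_Cons[of \<alpha> ns] step by simp
qed

lemma represents_foldr_twists:
  assumes "\<And>\<alpha>. \<alpha> \<in> set as \<Longrightarrow> represents (length ns) (F \<alpha>) (twist_op (single_class \<alpha> (s \<alpha>)))" "distinct as"
  shows "represents (length ns) (foldr (\<lambda>\<alpha> B. F \<alpha> * B) as (1\<^sub>m (2 * length ns + 4)))
    (twist_op (\<lambda>i. if i \<in> set as then s i else 0))"
  using assms
proof (induction as)
  case Nil
  then show ?case
    using represents_one twist_op_zero by (simp add: zero_fun_def)
next
  case (Cons a as)
  have "single_class a (s a) + (\<lambda>i. if i \<in> set as then s i else 0) = (\<lambda>i. if i \<in> set (a # as) then s i else 0)"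
    using Cons.prems by (auto simp: single_class_def)
  then show ?case
    using represents_mult[OF Cons.prems(1)[of a] Cons.IH] Cons.prems by (simp add: twist_op_add)
qed

lemma represents_ordered_prod:
  assumes "\<And>\<alpha>. \<alpha> \<in> {1..length ns} \<Longrightarrow> represents (length ns) (F \<alpha>) (twist_op (single_class \<alpha> (s \<alpha>)))"
  shows "represents (length ns) (ordered_prod (length ns) F) (twist_op (\<lambda>i. if i \<in> {1..length ns} then s i else 0))"
proof -
  have "set [1..<length ns + 1] = {1..length ns}"
    by auto
  then show ?thesis
    using represents_foldr_twists[of "[1..<length ns + 1]" F s] assms unfolding ordered_prod_def by simp
qed

text \<open>Left multiplication by T_N subtracts N times row D_0 from row C_0. Row D_0 of the twist
  is an identity row because \<open>anticanonical\<close> has no H_0 component, so the correction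
  stays confined to one entry.\<close>

lemma tower_eq_window:
  assumes "\<And>x y. x \<in> set (labels (length ns)) \<Longrightarrow> y \<in> set (labels (length ns)) \<Longrightarrow>
    box_kernel (factors ns 0) 0 0 x y = line_twist (length ns) (c3_num ns n nI) (- anticanonical ns) x y - delta x y
      - (if x = Lab_C 0 \<and> y = Lab_D 0 then N_num ns n nI else 0)"
  shows "1 + tower (factors ns 0) = unital_op (length ns)
     (\<lambda>x y. if x = Lab_C 0 \<and> y = Lab_D 0 then - N_num ns n nI else delta x y) * twist_op (- anticanonical ns)"
proof -
  let ?r = "length ns" and ?N = "N_num ns n nI"
  let ?T = "\<lambda>x y. if x = Lab_C 0 \<and> y = Lab_D 0 then - ?N else delta x y"
  have T: "?T x y = delta x y - (if x = Lab_C 0 \<and> y = Lab_D 0 then ?N else 0)" for x y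
    by simp
  have mult: "kernel_mult ?r ?T f x y = f x y - (if x = Lab_C 0 then ?N * f (Lab_D 0) y else 0)"
    if "x \<in> set (labels ?r)" for f x y
  proof -
    have "kernel_mult ?r (\<lambda>x y. if x = Lab_C 0 \<and> y = Lab_D 0 then ?N else 0) f x y
        = (\<Sum>z\<in>set (labels ?r). if z = Lab_D 0 then if x = Lab_C 0 then ?N * f (Lab_D 0) y else 0 else 0)"
      unfolding kernel_mult_def by (intro sum.cong) auto
    also have "\<dots> = (if x = Lab_C 0 then ?N * f (Lab_D 0) y else 0)"
      by (simp add: set_labels)
    finally show ?thesis
      using that by (simp only: T kernel_mult_diff kernel_mult_delta)
  qed
  have "1 + tower (factors ns 0) = 1 + kernel_op ?r (box_kernel (factors ns 0) 0 0)"
    using twist_tower_twist[of 0 "factors ns 0" 0] by (simp add: twist_op_zero)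
  also have "kernel_op ?r (box_kernel (factors ns 0) 0 0)
      = kernel_op ?r (\<lambda>x y. kernel_mult ?r ?T (line_twist ?r (c3_num ns n nI) (- anticanonical ns)) x y - delta x y)"
  proof (rule kernel_op_cong)
    fix x y assume xy: "x \<in> set (labels ?r)" "y \<in> set (labels ?r)"
    have "line_twist ?r (c3_num ns n nI) (- anticanonical ns) (Lab_D 0) y = delta (Lab_D 0) y"
      by (cases y) (simp_all add: anticanonical_def delta_def)
    then show "box_kernel (factors ns 0) 0 0 x y
        = kernel_mult ?r ?T (line_twist ?r (c3_num ns n nI) (- anticanonical ns)) x y - delta x y"
      unfolding assms[OF xy] mult[OF xy(1)] by (simp add: delta_def)
  qed
  finally show ?thesis
    unfolding unital_op_mult by (simp add: unital_op_def)
qed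

theorem window_monodromy:
  assumes beil: "beilinson (factors ns 0)"
    and box: "\<And>x y. x \<in> set (labels (length ns)) \<Longrightarrow> y \<in> set (labels (length ns)) \<Longrightarrow>
    box_kernel (factors ns 0) 0 0 x y = line_twist (length ns) (c3_num ns n nI) (- anticanonical ns) x y - delta x y
      - (if x = Lab_C 0 \<and> y = Lab_D 0 then N_num ns n nI else 0)"
  shows "M_mat ns n nI 0 * ordered_prod (length ns) (\<lambda>\<alpha>. L_mat ns n nI \<alpha> ^\<^sub>m n_comp ns \<alpha>)
           = T_N_mat ns n nI"
    and "M_mat ns n nI 0
           = T_N_mat ns n nI
             * ordered_prod (length ns) (\<lambda>\<alpha>. inv_mat (L_mat ns n nI \<alpha>) ^\<^sub>m n_comp ns \<alpha>)"
    and "\<alpha> \<in> {1..length ns} \<Longrightarrow>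
            (M_mat ns n nI \<alpha> * L_mat ns n nI \<alpha>) ^\<^sub>m n_comp ns \<alpha>
              = (L_mat ns n nI \<alpha> * M_mat ns n nI \<alpha>) ^\<^sub>m n_comp ns \<alpha>"
proof -
  let ?r = "length ns" and ?A = "anticanonical ns"
  have pow: "represents ?r (L_mat ns n nI \<alpha> ^\<^sub>m n_comp ns \<alpha>) (twist_op (single_class \<alpha> (of_nat (n_comp ns \<alpha>))))"
    "represents ?r (inv_mat (L_mat ns n nI \<alpha>) ^\<^sub>m n_comp ns \<alpha>) (twist_op (single_class \<alpha> (- of_nat (n_comp ns \<alpha>))))"
    if "\<alpha> \<in> {1..?r}" for \<alpha>
    using represents_pow[OF represents_L, of \<alpha> "n_comp ns \<alpha>"] represents_pow[OF represents_inv_L, of \<alpha> "n_comp ns \<alpha>"] that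
    by (simp_all add: single_class_pow)
  have "(\<lambda>i. if i \<in> {1..?r} then - of_nat (n_comp ns i) else 0) = - ?A"
    "(\<lambda>i. if i \<in> {1..?r} then of_nat (n_comp ns i) else 0) = ?A"
    by (auto simp: anticanonical_def)
  then have prods:
    "represents ?r (ordered_prod ?r (\<lambda>\<alpha>. L_mat ns n nI \<alpha> ^\<^sub>m n_comp ns \<alpha>)) (twist_op ?A)"
    "represents ?r (ordered_prod ?r (\<lambda>\<alpha>. inv_mat (L_mat ns n nI \<alpha>) ^\<^sub>m n_comp ns \<alpha>)) (twist_op (- ?A))"
    using represents_ordered_prod[OF pow(1)] represents_ordered_prod[OF pow(2)] by simp_all
  have window: "1 + tower (factors ns 0) = unital_op ?r
      (\<lambda>x y. if x = Lab_C 0 \<and> y = Lab_D 0 then - N_num ns n nI else delta x y) * twist_op (- ?A)"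
    by (rule tower_eq_window) (rule box)
  note M0 = represents_M[OF beil le0, unfolded window]
  have TN: "represents ?r (T_N_mat ns n nI)
      (unital_op ?r (\<lambda>x y. if x = Lab_C 0 \<and> y = Lab_D 0 then - N_num ns n nI else delta x y))"
    unfolding T_N_mat_def by (rule represents_block_mat)
  have "twist_op (- ?A) * twist_op ?A = 1"
    by (simp add: twist_op_add twist_op_zero)
  then have "represents ?r (M_mat ns n nI 0 * ordered_prod ?r (\<lambda>\<alpha>. L_mat ns n nI \<alpha> ^\<^sub>m n_comp ns \<alpha>))
      (unital_op ?r (\<lambda>x y. if x = Lab_C 0 \<and> y = Lab_D 0 then - N_num ns n nI else delta x y))"
    using represents_mult[OF M0 prods(1)] by (simp only: mult.assoc mult_1_right)
  then show "M_mat ns n nI 0 * ordered_prod ?r (\<lambda>\<alpha>. L_mat ns n nI \<alpha> ^\<^sub>m n_comp ns \<alpha>) = T_N_mat ns n nI"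
    using TN by (rule represents_unique)
  show "M_mat ns n nI 0 = T_N_mat ns n nI
      * ordered_prod ?r (\<lambda>\<alpha>. inv_mat (L_mat ns n nI \<alpha>) ^\<^sub>m n_comp ns \<alpha>)"
    using represents_unique[OF M0 represents_mult[OF TN prods(2)]] by simp
  assume \<alpha>: "\<alpha> \<in> {1..?r}"
  then have reps: "represents ?r (M_mat ns n nI \<alpha>) (1 + tower (factors ns \<alpha>))"
    "represents ?r (L_mat ns n nI \<alpha>) (twist_op (single_class \<alpha> 1))"
    using represents_M[OF beil] represents_L by auto
  have "beilinson ((n_comp ns \<alpha>, \<alpha>) # factors ns \<alpha>)"
  proof -
    obtain \<beta> where \<beta>: "\<alpha> = \<beta> + 1" "\<beta> < ?r"
      using \<alpha> by (cases \<alpha>) auto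
    show ?thesis
      using beilinson_factors[OF beil, of \<beta>] factors_Cons[OF \<beta>(2)] \<beta> by simp
  qed
  then show "(M_mat ns n nI \<alpha> * L_mat ns n nI \<alpha>) ^\<^sub>m n_comp ns \<alpha>
      = (L_mat ns n nI \<alpha> * M_mat ns n nI \<alpha>) ^\<^sub>m n_comp ns \<alpha>"
    using represents_unique[OF represents_pow[OF represents_mult[OF reps]]]
      represents_pow[OF represents_mult[OF reps(2,1)]] tower_power_commute by metis
qed

end

section \<open>Numerical verification\<close>

text \<open>The integral over \<open>Y\<close> of the monomial in the hyperplane classes with the given list of indices.\<close>

definition top_coeff :: "nat list \<Rightarrow> nat list \<Rightarrow> rat" where
  "top_coeff ns xs = (if map (count_list xs) [1..<length ns + 1] = map (\<lambda>m. m - 1) ns then 1 else 0)"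

lemma alt_binom_simps:
  "alt_binom n 0 = 1" "alt_binom 2 (Suc 0) = - 2" "alt_binom 2 2 = 1"
  "alt_binom 3 (Suc 0) = - 3" "alt_binom 3 2 = 3" "alt_binom 3 3 = - 1"
  "alt_binom 4 (Suc 0) = - 4" "alt_binom 4 2 = 6" "alt_binom 4 3 = - 4" "alt_binom 4 4 = 1"
  "alt_binom 5 (Suc 0) = - 5" "alt_binom 5 2 = 10" "alt_binom 5 3 = - 10" "alt_binom 5 4 = 5" "alt_binom 5 5 = - 1"
  by (simp_all add: alt_binom_def binomial_eq_0 numeral_eq_Suc)

text \<open>The sum behind \<open>box_kernel\<close> with an abstract summand, which can thus be
  simplified once for symbolic \<open>u\<close> and \<open>w\<close> before the box is expanded. The
  index \<open>i\<close> is the last coordinate already fixed.\<close>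

primrec box_sum :: "nat \<Rightarrow> nat list \<Rightarrow> ((nat \<Rightarrow> rat) \<Rightarrow> (nat \<Rightarrow> rat) \<Rightarrow> rat) \<Rightarrow> rat" where
  "box_sum i [] f = f 0 0"
| "box_sum i (m # ms) f = (\<Sum>j<m. \<Sum>k\<le>j. of_int (alt_binom m (j - k)) *
     box_sum (Suc i) ms (\<lambda>u w. f (u(Suc i := of_nat k)) (w(Suc i := - of_nat j))))"

lemma box_sum_cong_strong:
  "(\<And>u w. (\<forall>j\<le>i. u j = 0 \<and> w j = 0) \<Longrightarrow> f u w = g u w) \<Longrightarrow> box_sum i ms f = box_sum i ms g"
proof (induction ms arbitrary: i f g)
  case (Cons m ms)
  show ?case
    unfolding box_sum.simps
    by (intro sum.cong refl arg_cong[where f = "\<lambda>t. _ * t"] Cons.IH Cons.prems) auto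
qed simp

text \<open>As a congruence rule, this lets the simplifier discard the coordinates of index \<open>0\<close> before unfolding the sum.\<close>

lemma box_sum_cong:
  assumes "ms = ms'" "\<And>u w. u 0 = 0 \<Longrightarrow> w 0 = 0 \<Longrightarrow> f u w = g u w"
  shows "box_sum i ms f = box_sum i ms' g"
  unfolding assms(1) by (rule box_sum_cong_strong) (simp add: assms(2))

lemma box_sum_unfold:
  "box_sum i (2 # ms) f =
     box_sum (Suc i) ms (\<lambda>u w. f (u(Suc i := 0)) (w(Suc i := 0)))
     - 2 * box_sum (Suc i) ms (\<lambda>u w. f (u(Suc i := 0)) (w(Suc i := - 1)))
     + box_sum (Suc i) ms (\<lambda>u w. f (u(Suc i := 1)) (w(Suc i := - 1)))"
  "box_sum i (3 # ms) f =
     box_sum (Suc i) ms (\<lambda>u w. f (u(Suc i := 0)) (w(Suc i := 0)))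
     - 3 * box_sum (Suc i) ms (\<lambda>u w. f (u(Suc i := 0)) (w(Suc i := - 1)))
     + box_sum (Suc i) ms (\<lambda>u w. f (u(Suc i := 1)) (w(Suc i := - 1)))
     + 3 * box_sum (Suc i) ms (\<lambda>u w. f (u(Suc i := 0)) (w(Suc i := - 2)))
     - 3 * box_sum (Suc i) ms (\<lambda>u w. f (u(Suc i := 1)) (w(Suc i := - 2)))
     + box_sum (Suc i) ms (\<lambda>u w. f (u(Suc i := 2)) (w(Suc i := - 2)))"
  "box_sum i (4 # ms) f =
     box_sum (Suc i) ms (\<lambda>u w. f (u(Suc i := 0)) (w(Suc i := 0)))
     - 4 * box_sum (Suc i) ms (\<lambda>u w. f (u(Suc i := 0)) (w(Suc i := - 1)))
     + box_sum (Suc i) ms (\<lambda>u w. f (u(Suc i := 1)) (w(Suc i := - 1)))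
     + 6 * box_sum (Suc i) ms (\<lambda>u w. f (u(Suc i := 0)) (w(Suc i := - 2)))
     - 4 * box_sum (Suc i) ms (\<lambda>u w. f (u(Suc i := 1)) (w(Suc i := - 2)))
     + box_sum (Suc i) ms (\<lambda>u w. f (u(Suc i := 2)) (w(Suc i := - 2)))
     - 4 * box_sum (Suc i) ms (\<lambda>u w. f (u(Suc i := 0)) (w(Suc i := - 3)))
     + 6 * box_sum (Suc i) ms (\<lambda>u w. f (u(Suc i := 1)) (w(Suc i := - 3)))
     - 4 * box_sum (Suc i) ms (\<lambda>u w. f (u(Suc i := 2)) (w(Suc i := - 3)))
     + box_sum (Suc i) ms (\<lambda>u w. f (u(Suc i := 3)) (w(Suc i := - 3)))"
  "box_sum i (5 # ms) f =
     box_sum (Suc i) ms (\<lambda>u w. f (u(Suc i := 0)) (w(Suc i := 0)))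
     - 5 * box_sum (Suc i) ms (\<lambda>u w. f (u(Suc i := 0)) (w(Suc i := - 1)))
     + box_sum (Suc i) ms (\<lambda>u w. f (u(Suc i := 1)) (w(Suc i := - 1)))
     + 10 * box_sum (Suc i) ms (\<lambda>u w. f (u(Suc i := 0)) (w(Suc i := - 2)))
     - 5 * box_sum (Suc i) ms (\<lambda>u w. f (u(Suc i := 1)) (w(Suc i := - 2)))
     + box_sum (Suc i) ms (\<lambda>u w. f (u(Suc i := 2)) (w(Suc i := - 2)))
     - 10 * box_sum (Suc i) ms (\<lambda>u w. f (u(Suc i := 0)) (w(Suc i := - 3)))
     + 10 * box_sum (Suc i) ms (\<lambda>u w. f (u(Suc i := 1)) (w(Suc i := - 3)))
     - 5 * box_sum (Suc i) ms (\<lambda>u w. f (u(Suc i := 2)) (w(Suc i := - 3)))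
     + box_sum (Suc i) ms (\<lambda>u w. f (u(Suc i := 3)) (w(Suc i := - 3)))
     + 5 * box_sum (Suc i) ms (\<lambda>u w. f (u(Suc i := 0)) (w(Suc i := - 4)))
     - 10 * box_sum (Suc i) ms (\<lambda>u w. f (u(Suc i := 1)) (w(Suc i := - 4)))
     + 10 * box_sum (Suc i) ms (\<lambda>u w. f (u(Suc i := 2)) (w(Suc i := - 4)))
     - 5 * box_sum (Suc i) ms (\<lambda>u w. f (u(Suc i := 3)) (w(Suc i := - 4)))
     + box_sum (Suc i) ms (\<lambda>u w. f (u(Suc i := 4)) (w(Suc i := - 4)))"
  by (simp_all add: lessThan_nat_numeral atMost_nat_numeral alt_binom_simps algebra_simps)

lemma all_less_numeral: "(\<forall>j<numeral k. P j) \<longleftrightarrow> (\<forall>j<pred_numeral k. P j) \<and> P (pred_numeral k)"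
  by (metis All_less_Suc numeral_eq_Suc)

lemma all_between_numeral: "(\<forall>m>0. m < numeral k \<longrightarrow> P m) \<longleftrightarrow> (\<forall>m<pred_numeral k. P (Suc m))"
  by (simp add: numeral_eq_Suc) (metis Suc_less_eq Suc_pred zero_less_Suc)

lemma choose_simps:
  "4 choose 2 = 6" "5 choose 2 = 10" "6 choose 2 = 15" "6 choose 3 = 20" "7 choose 3 = 35" "8 choose 4 = 70"
  by (simp_all add: numeral_eq_Suc)

context spherical_twist
begin

text \<open>\<open>u\<close> and \<open>w\<close> vanish beyond \<open>i\<close>, so adding to
  coordinate \<open>Suc i\<close>, as \<open>box_kernel\<close> does, agrees with overwriting it, as
  \<open>box_sum\<close> does.\<close>

lemma box_kernel_eq_box_sum:
  "\<forall>j>i. u j = 0 \<and> w j = 0 \<Longrightarrow>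
   box_kernel (map (\<lambda>k. (ms ! k, Suc (i + k))) [0..<length ms]) u w x y
     = box_sum i ms (\<lambda>u' w'. line_twist r c (u + u') x Lab_O * euler_twist (w + w') y)"
proof (induction ms arbitrary: i u w)
  case (Cons m ms)
  have list: "map (\<lambda>k. ((m # ms) ! k, Suc (i + k))) [0..<length (m # ms)]
      = (m, Suc i) # map (\<lambda>k. (ms ! k, Suc (Suc i + k))) [0..<length ms]"
    by (simp add: upt_conv_Cons map_Suc_upt[symmetric] comp_def del: upt_Suc)
  have "box_kernel (map (\<lambda>k. (ms ! k, Suc (Suc i + k))) [0..<length ms])
        (u(Suc i := u (Suc i) + of_nat k)) (w(Suc i := w (Suc i) - of_nat j)) x y
      = box_sum (Suc i) ms (\<lambda>u' w'. line_twist r c (u + u'(Suc i := of_nat k)) x Lab_O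
          * euler_twist (w + w'(Suc i := - of_nat j)) y)" for j k
  proof -
    have upd: "u(Suc i := u (Suc i) + of_nat k) + u' = u + u'(Suc i := of_nat k)"
      "w(Suc i := w (Suc i) - of_nat j) + w' = w + w'(Suc i := - of_nat j)"
      if "\<forall>j\<le>Suc i. u' j = 0 \<and> w' j = 0" for u' w'
      using that by (auto simp: fun_eq_iff)
    have "box_kernel (map (\<lambda>k. (ms ! k, Suc (Suc i + k))) [0..<length ms])
        (u(Suc i := u (Suc i) + of_nat k)) (w(Suc i := w (Suc i) - of_nat j)) x y
      = box_sum (Suc i) ms (\<lambda>u' w'. line_twist r c (u(Suc i := u (Suc i) + of_nat k) + u') x Lab_O
          * euler_twist (w(Suc i := w (Suc i) - of_nat j) + w') y)"
      using Cons.prems by (intro Cons.IH) auto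
    also have "\<dots> = box_sum (Suc i) ms (\<lambda>u' w'. line_twist r c (u + u'(Suc i := of_nat k)) x Lab_O
          * euler_twist (w + w'(Suc i := - of_nat j)) y)"
      by (rule box_sum_cong_strong) (simp only: upd)
    finally show ?thesis .
  qed
  then show ?case
    unfolding list box_kernel.simps box_sum.simps prod.case by (simp only:)
qed simp

text \<open>The entries of L_\<alpha>^t are polynomials of degree at most 3 in t, and the n-th
  difference kills degrees below n. For n = 3 the cubic term must vanish, for n = 2 also the
  quadratic ones; these are H_\<alpha>^3 = 0 on a plane and H_\<alpha>^2 = 0 on a line.\<close>

lemma koszulI:
  assumes "\<alpha> \<le> r" "n \<in> {2, 3, 4, 5}"
    and "n = 2 \<Longrightarrow> \<forall>\<gamma>\<in>{..r}. c \<alpha> \<alpha> \<gamma> = 0" "n = 3 \<Longrightarrow> c \<alpha> \<alpha> \<alpha> = 0"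
  shows "koszul n \<alpha>"
proof -
  let ?f = "\<lambda>d x y. of_int (alt_binom n d) * (line_twist r c (single_class \<alpha> (of_nat (n - d))) x y - delta x y)"
  \<comment> \<open>The sum is (1 - 1)^n; it removes the identity parts of the operators, leaving
    finitely many entries to check.\<close>
  have coeffs: "(\<Sum>d\<le>n. alt_binom n d) = 0"
    using assms(2) by (auto simp: atMost_nat_numeral alt_binom_simps)
  have "(\<Sum>d\<le>n. of_int (alt_binom n d) * twist_op (single_class \<alpha> 1) ^ (n - d))
      = (\<Sum>d\<le>n. of_int (alt_binom n d)) + kernel_op r (\<lambda>x y. \<Sum>d\<le>n. ?f d x y)"
    unfolding single_class_pow mult_1_right unfolding unital_op_def
    by (simp add: distrib_left kernel_op_of_int sum.distrib flip: kernel_op_sum)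
  also have "kernel_op r (\<lambda>x y. \<Sum>d\<le>n. ?f d x y) = kernel_op r (\<lambda>x y. 0)"
  proof (rule kernel_op_cong)
    fix x y assume xy: "x \<in> set (labels r)" "y \<in> set (labels r)"
    show "(\<Sum>d\<le>n. ?f d x y) = 0"
      by (cases x; cases y; insert xy assms)
        (auto simp: line_twist_single atMost_nat_numeral alt_binom_simps set_labels algebra_simps
            add_divide_distrib diff_divide_distrib
          simp del: line_twist.simps(1-6))
  qed
  finally show ?thesis
    by (simp add: koszul_def coeffs kernel_op_zero flip: of_int_sum)
qed

end

text \<open>
  The splitting enters only through the coefficients \<open>a\<close> of the quadratic form \<open>A\<^sub>2\<close> and through the
  values \<open>c 0 0 \<alpha>\<close> and \<open>l 0\<close>, which are unconstrained.
\<close>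

locale splitting_numbers = spherical_twist "length ns" c l
  for ns :: "nat list" and c :: "nat \<Rightarrow> nat \<Rightarrow> nat \<Rightarrow> rat" and l :: "nat \<Rightarrow> rat" +
  fixes a :: "nat \<Rightarrow> nat \<Rightarrow> rat" and N :: rat
  assumes c_Y: "\<alpha> \<in> set [1..<length ns + 1] \<Longrightarrow> \<beta> \<in> set [1..<length ns + 1] \<Longrightarrow> \<gamma> \<in> set [1..<length ns + 1] \<Longrightarrow>
      c \<alpha> \<beta> \<gamma> = (\<Sum>\<delta>\<leftarrow>[1..<length ns + 1]. of_nat (n_comp ns \<delta>) * top_coeff ns [\<alpha>, \<beta>, \<gamma>, \<delta>])"
    and c_0: "\<alpha> \<in> set [1..<length ns + 1] \<Longrightarrow> \<beta> \<in> set [1..<length ns + 1] \<Longrightarrow>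
      c 0 \<alpha> \<beta> = (\<Sum>\<gamma>\<leftarrow>[1..<length ns + 1]. \<Sum>\<delta>\<leftarrow>[1..<length ns + 1]. a \<gamma> \<delta> * top_coeff ns [\<alpha>, \<beta>, \<gamma>, \<delta>])"
    and a_swap: "a \<alpha> \<beta> = a \<beta> \<alpha>"
    and l_Y: "\<alpha> \<in> set [1..<length ns + 1] \<Longrightarrow> l \<alpha> = c \<alpha> \<alpha> \<alpha> / 6
      + ((\<Sum>\<beta>\<leftarrow>[1..<length ns + 1]. \<Sum>\<gamma>\<leftarrow>[1..<length ns + 1]. \<Sum>\<delta>\<leftarrow>[1..<length ns + 1].
            of_nat (n_comp ns \<beta> * n_comp ns \<gamma> * n_comp ns \<delta>) * top_coeff ns [\<alpha>, \<beta>, \<gamma>, \<delta>])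
         - (\<Sum>\<beta>\<leftarrow>[1..<length ns + 1]. \<Sum>\<gamma>\<leftarrow>[1..<length ns + 1].
            of_nat (n_comp ns \<beta> * n_comp ns \<gamma>) * top_coeff ns [\<alpha>, \<beta>, \<beta>, \<gamma>])) / 24"
    and N_eq: "N = (\<Sum>\<gamma>\<leftarrow>[1..<length ns + 1]. \<Sum>\<delta>\<leftarrow>[1..<length ns + 1]. a \<gamma> \<delta> * c 0 \<gamma> \<delta>)
      - (\<Sum>\<delta>\<leftarrow>[1..<length ns + 1]. of_nat (n_comp ns \<delta>) * c 0 0 \<delta>)"
begin

text \<open>Bounded quantification over an explicit list turns into a finite table of rewrite rules
  in which each \<open>top_coeff\<close> is evaluated.\<close>

lemma c_Y_all: "\<forall>\<alpha>\<in>set [1..<length ns + 1]. \<forall>\<beta>\<in>set [1..<length ns + 1]. \<forall>\<gamma>\<in>set [1..<length ns + 1].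
    c \<alpha> \<beta> \<gamma> = (\<Sum>\<delta>\<leftarrow>[1..<length ns + 1]. of_nat (n_comp ns \<delta>) * top_coeff ns [\<alpha>, \<beta>, \<gamma>, \<delta>])"
  using c_Y by blast

lemma c_0_all: "\<forall>\<alpha>\<in>set [1..<length ns + 1]. \<forall>\<beta>\<in>set [1..<length ns + 1].
    c 0 \<alpha> \<beta> = (\<Sum>\<gamma>\<leftarrow>[1..<length ns + 1]. \<Sum>\<delta>\<leftarrow>[1..<length ns + 1]. a \<gamma> \<delta> * top_coeff ns [\<alpha>, \<beta>, \<gamma>, \<delta>])"
  using c_0 by blast

lemma l_Y_all: "\<forall>\<alpha>\<in>set [1..<length ns + 1]. l \<alpha> = c \<alpha> \<alpha> \<alpha> / 6
      + ((\<Sum>\<beta>\<leftarrow>[1..<length ns + 1]. \<Sum>\<gamma>\<leftarrow>[1..<length ns + 1]. \<Sum>\<delta>\<leftarrow>[1..<length ns + 1].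
            of_nat (n_comp ns \<beta> * n_comp ns \<gamma> * n_comp ns \<delta>) * top_coeff ns [\<alpha>, \<beta>, \<gamma>, \<delta>])
         - (\<Sum>\<beta>\<leftarrow>[1..<length ns + 1]. \<Sum>\<gamma>\<leftarrow>[1..<length ns + 1].
            of_nat (n_comp ns \<beta> * n_comp ns \<gamma>) * top_coeff ns [\<alpha>, \<beta>, \<beta>, \<gamma>])) / 24"
  using l_Y by blast

text \<open>Zeros are moved to the front, so that a number with one zero matches
  \<open>c_0_all\<close> and one with two zeros gets the single symbolic form
  c_{00\<alpha>}.\<close>

lemma c_0_sort:
  "c (Suc 0) 0 \<beta> = c 0 (Suc 0) \<beta>" "c (numeral k) 0 \<beta> = c 0 (numeral k) \<beta>"
  "c (Suc 0) \<beta> 0 = c 0 (Suc 0) \<beta>" "c (numeral k) \<beta> 0 = c 0 (numeral k) \<beta>"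
  "c 0 (Suc 0) 0 = c 0 0 (Suc 0)" "c 0 (numeral k) 0 = c 0 0 (numeral k)"
  by (simp_all add: c_swap)

lemmas intersection_numbers = c_Y_all c_0_all l_Y_all N_eq

lemmas number_rules = c_0_sort euler_twist_simps a_swap

lemmas beilinson_rules = koszulI all_less_numeral all_between_numeral All_less_Suc choose_simps single_class_def

definition box_identity :: bool where
  "box_identity \<longleftrightarrow> (\<forall>x\<in>set (labels (length ns)). \<forall>y\<in>set (labels (length ns)).
     box_sum 0 ns (\<lambda>u w. line_twist (length ns) c u x Lab_O * euler_twist w y)
       = line_twist (length ns) c (- anticanonical ns) x y - delta x y - (if x = Lab_C 0 \<and> y = Lab_D 0 then N else 0))"

end

section \<open>The box identity for the eight ordered lists\<close>

context splitting_numbers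
begin

text \<open>For explicit \<open>ns\<close> every matrix entry is a polynomial identity in the
  symbols left free by the locale. Each ordering is a separate case, since the nesting of the tower,
  and hence the acyclicity to be checked, depends on it.\<close>

lemma box_identity_beilinson_5:
  assumes ns: "ns = [5]"
  shows "box_identity" "beilinson (factors ns 0)"
proof -
  have upt: "[1..<length ns + 1] = [1]"
    and atMost: "{..length ns} = {0, 1}" "\<forall>i\<in>{0, 1}. i \<le> length ns"
    and factors: "factors ns 0 = [(5, 1)]"
    and anticanonical: "\<forall>i\<in>{0, 1}. anticanonical ns i = [0, 5] ! i"
    and box_sum: "box_sum 0 ns f = box_sum 0 [5] f" for f
    by (auto simp: ns factors_def anticanonical_def upt_conv_Cons)
  note numbers = intersection_numbers[unfolded top_coeff_def upt, simplified ns, simplified]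
  show "box_identity"
    unfolding box_identity_def set_labels atMost(1) box_sum
    \<comment> \<open>The summand is first reduced under \<open>box_sum_cong\<close>, with the H_0
      coordinates of both shifts set to zero; only the second call expands the box. Folding
      \<open>Suc (Suc 0)\<close> back to 2 keeps the indices in the form used by the table.\<close>
    by (simp add: atMost numbers anticanonical number_rules del: box_sum.simps cong: box_sum_cong)
      (simp add: box_sum_unfold numeral_2_eq_2[symmetric] numbers number_rules algebra_simps add_divide_distrib diff_divide_distrib
        del: box_sum.simps(2))
  show "beilinson (factors ns 0)"
    unfolding factors by (simp add: beilinson_rules numeral_2_eq_2[symmetric] atMost numbers number_rules)
qed

lemma box_identity_beilinson_33:
  assumes ns: "ns = [3, 3]"
  shows "box_identity" "beilinson (factors ns 0)"
proof -
  have upt: "[1..<length ns + 1] = [1, 2]"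
    and atMost: "{..length ns} = {0, 1, 2}" "\<forall>i\<in>{0, 1, 2}. i \<le> length ns"
    and factors: "factors ns 0 = [(3, 1), (3, 2)]"
    and anticanonical: "\<forall>i\<in>{0, 1, 2}. anticanonical ns i = [0, 3, 3] ! i"
    and box_sum: "box_sum 0 ns f = box_sum 0 [3, 3] f" for f
    by (auto simp: ns factors_def anticanonical_def upt_conv_Cons)
  note numbers = intersection_numbers[unfolded top_coeff_def upt, simplified ns, simplified]
  show "box_identity"
    unfolding box_identity_def set_labels atMost(1) box_sum
    by (simp add: atMost numbers anticanonical number_rules del: box_sum.simps cong: box_sum_cong)
      (simp add: box_sum_unfold numeral_2_eq_2[symmetric] numbers number_rules algebra_simps add_divide_distrib diff_divide_distrib
        del: box_sum.simps(2))
  show "beilinson (factors ns 0)"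
    unfolding factors by (simp add: beilinson_rules numeral_2_eq_2[symmetric] atMost numbers number_rules)
qed

lemma box_identity_beilinson_42:
  assumes ns: "ns = [4, 2]"
  shows "box_identity" "beilinson (factors ns 0)"
proof -
  have upt: "[1..<length ns + 1] = [1, 2]"
    and atMost: "{..length ns} = {0, 1, 2}" "\<forall>i\<in>{0, 1, 2}. i \<le> length ns"
    and factors: "factors ns 0 = [(4, 1), (2, 2)]"
    and anticanonical: "\<forall>i\<in>{0, 1, 2}. anticanonical ns i = [0, 4, 2] ! i"
    and box_sum: "box_sum 0 ns f = box_sum 0 [4, 2] f" for f
    by (auto simp: ns factors_def anticanonical_def upt_conv_Cons)
  note numbers = intersection_numbers[unfolded top_coeff_def upt, simplified ns, simplified]
  show "box_identity"
    unfolding box_identity_def set_labels atMost(1) box_sum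
    by (simp add: atMost numbers anticanonical number_rules del: box_sum.simps cong: box_sum_cong)
      (simp add: box_sum_unfold numeral_2_eq_2[symmetric] numbers number_rules algebra_simps add_divide_distrib diff_divide_distrib
        del: box_sum.simps(2))
  show "beilinson (factors ns 0)"
    unfolding factors by (simp add: beilinson_rules numeral_2_eq_2[symmetric] atMost numbers number_rules)
qed

lemma box_identity_beilinson_24:
  assumes ns: "ns = [2, 4]"
  shows "box_identity" "beilinson (factors ns 0)"
proof -
  have upt: "[1..<length ns + 1] = [1, 2]"
    and atMost: "{..length ns} = {0, 1, 2}" "\<forall>i\<in>{0, 1, 2}. i \<le> length ns"
    and factors: "factors ns 0 = [(2, 1), (4, 2)]"
    and anticanonical: "\<forall>i\<in>{0, 1, 2}. anticanonical ns i = [0, 2, 4] ! i"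
    and box_sum: "box_sum 0 ns f = box_sum 0 [2, 4] f" for f
    by (auto simp: ns factors_def anticanonical_def upt_conv_Cons)
  note numbers = intersection_numbers[unfolded top_coeff_def upt, simplified ns, simplified]
  show "box_identity"
    unfolding box_identity_def set_labels atMost(1) box_sum
    by (simp add: atMost numbers anticanonical number_rules del: box_sum.simps cong: box_sum_cong)
      (simp add: box_sum_unfold numeral_2_eq_2[symmetric] numbers number_rules algebra_simps add_divide_distrib diff_divide_distrib
        del: box_sum.simps(2))
  show "beilinson (factors ns 0)"
    unfolding factors by (simp add: beilinson_rules numeral_2_eq_2[symmetric] atMost numbers number_rules)
qed

lemma box_identity_beilinson_322:
  assumes ns: "ns = [3, 2, 2]"
  shows "box_identity" "beilinson (factors ns 0)"
proof -
  have upt: "[1..<length ns + 1] = [1, 2, 3]"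
    and atMost: "{..length ns} = {0, 1, 2, 3}" "\<forall>i\<in>{0, 1, 2, 3}. i \<le> length ns"
    and factors: "factors ns 0 = [(3, 1), (2, 2), (2, 3)]"
    and anticanonical: "\<forall>i\<in>{0, 1, 2, 3}. anticanonical ns i = [0, 3, 2, 2] ! i"
    and box_sum: "box_sum 0 ns f = box_sum 0 [3, 2, 2] f" for f
    by (auto simp: ns factors_def anticanonical_def upt_conv_Cons)
  note numbers = intersection_numbers[unfolded top_coeff_def upt, simplified ns, simplified]
  show "box_identity"
    unfolding box_identity_def set_labels atMost(1) box_sum
    by (simp add: atMost numbers anticanonical number_rules del: box_sum.simps cong: box_sum_cong)
      (simp add: box_sum_unfold numeral_2_eq_2[symmetric] numbers number_rules algebra_simps add_divide_distrib diff_divide_distrib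
        del: box_sum.simps(2))
  show "beilinson (factors ns 0)"
    unfolding factors by (simp add: beilinson_rules numeral_2_eq_2[symmetric] atMost numbers number_rules)
qed

lemma box_identity_beilinson_232:
  assumes ns: "ns = [2, 3, 2]"
  shows "box_identity" "beilinson (factors ns 0)"
proof -
  have upt: "[1..<length ns + 1] = [1, 2, 3]"
    and atMost: "{..length ns} = {0, 1, 2, 3}" "\<forall>i\<in>{0, 1, 2, 3}. i \<le> length ns"
    and factors: "factors ns 0 = [(2, 1), (3, 2), (2, 3)]"
    and anticanonical: "\<forall>i\<in>{0, 1, 2, 3}. anticanonical ns i = [0, 2, 3, 2] ! i"
    and box_sum: "box_sum 0 ns f = box_sum 0 [2, 3, 2] f" for f
    by (auto simp: ns factors_def anticanonical_def upt_conv_Cons)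
  note numbers = intersection_numbers[unfolded top_coeff_def upt, simplified ns, simplified]
  show "box_identity"
    unfolding box_identity_def set_labels atMost(1) box_sum
    by (simp add: atMost numbers anticanonical number_rules del: box_sum.simps cong: box_sum_cong)
      (simp add: box_sum_unfold numeral_2_eq_2[symmetric] numbers number_rules algebra_simps add_divide_distrib diff_divide_distrib
        del: box_sum.simps(2))
  show "beilinson (factors ns 0)"
    unfolding factors by (simp add: beilinson_rules numeral_2_eq_2[symmetric] atMost numbers number_rules)
qed

lemma box_identity_beilinson_223:
  assumes ns: "ns = [2, 2, 3]"
  shows "box_identity" "beilinson (factors ns 0)"
proof -
  have upt: "[1..<length ns + 1] = [1, 2, 3]"
    and atMost: "{..length ns} = {0, 1, 2, 3}" "\<forall>i\<in>{0, 1, 2, 3}. i \<le> length ns"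
    and factors: "factors ns 0 = [(2, 1), (2, 2), (3, 3)]"
    and anticanonical: "\<forall>i\<in>{0, 1, 2, 3}. anticanonical ns i = [0, 2, 2, 3] ! i"
    and box_sum: "box_sum 0 ns f = box_sum 0 [2, 2, 3] f" for f
    by (auto simp: ns factors_def anticanonical_def upt_conv_Cons)
  note numbers = intersection_numbers[unfolded top_coeff_def upt, simplified ns, simplified]
  show "box_identity"
    unfolding box_identity_def set_labels atMost(1) box_sum
    by (simp add: atMost numbers anticanonical number_rules del: box_sum.simps cong: box_sum_cong)
      (simp add: box_sum_unfold numeral_2_eq_2[symmetric] numbers number_rules algebra_simps add_divide_distrib diff_divide_distrib
        del: box_sum.simps(2))
  show "beilinson (factors ns 0)"
    unfolding factors by (simp add: beilinson_rules numeral_2_eq_2[symmetric] atMost numbers number_rules)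
qed

lemma box_identity_beilinson_2222:
  assumes ns: "ns = [2, 2, 2, 2]"
  shows "box_identity" "beilinson (factors ns 0)"
proof -
  have upt: "[1..<length ns + 1] = [1, 2, 3, 4]"
    and atMost: "{..length ns} = {0, 1, 2, 3, 4}" "\<forall>i\<in>{0, 1, 2, 3, 4}. i \<le> length ns"
    and factors: "factors ns 0 = [(2, 1), (2, 2), (2, 3), (2, 4)]"
    and anticanonical: "\<forall>i\<in>{0, 1, 2, 3, 4}. anticanonical ns i = [0, 2, 2, 2, 2] ! i"
    and box_sum: "box_sum 0 ns f = box_sum 0 [2, 2, 2, 2] f" for f
    by (auto simp: ns factors_def anticanonical_def upt_conv_Cons)
  note numbers = intersection_numbers[unfolded top_coeff_def upt, simplified ns, simplified]
  show "box_identity"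
    unfolding box_identity_def set_labels atMost(1) box_sum
    by (simp add: atMost numbers anticanonical number_rules del: box_sum.simps cong: box_sum_cong)
      (simp add: box_sum_unfold numeral_2_eq_2[symmetric] numbers number_rules algebra_simps add_divide_distrib diff_divide_distrib
        del: box_sum.simps(2))
  show "beilinson (factors ns 0)"
    unfolding factors by (simp add: beilinson_rules numeral_2_eq_2[symmetric] atMost numbers number_rules)
qed

end

section \<open>Intersection numbers of splitting configurations\<close>

lemma hyp_power: "hyp \<alpha> ^ i = Poly_Mapping.single (Poly_Mapping.single \<alpha> i) 1"
proof (induction i)
  case (Suc i)
  have "Poly_Mapping.single \<alpha> (Suc i) = Poly_Mapping.single \<alpha> 1 + Poly_Mapping.single \<alpha> i"
    by (simp flip: single_add)
  then show ?case
    by (simp add: Suc mult_single) (simp add: hyp_def mult_single)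
qed simp

text \<open>The classes pulled back from \<open>Y\<close>.\<close>

definition Y_classes :: "cls set" where
  "Y_classes = {\<omega>. \<forall>m\<in>Poly_Mapping.keys \<omega>. Poly_Mapping.lookup m 0 = 0}"

lemma Y_classes_add: "\<omega> \<in> Y_classes \<Longrightarrow> \<eta> \<in> Y_classes \<Longrightarrow> \<omega> + \<eta> \<in> Y_classes"
  using Poly_Mapping.keys_add[of \<omega> \<eta>] by (fastforce simp: Y_classes_def)

lemma Y_classes_mult: "\<omega> \<in> Y_classes \<Longrightarrow> \<eta> \<in> Y_classes \<Longrightarrow> \<omega> * \<eta> \<in> Y_classes"
  using Poly_Mapping.keys_mult[of \<omega> \<eta>] by (fastforce simp: Y_classes_def lookup_add)

lemma Y_classes_0 [simp]: "0 \<in> Y_classes"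
  by (simp add: Y_classes_def)

lemma Y_classes_1 [simp]: "1 \<in> Y_classes"
  by (simp add: Y_classes_def)

lemma Y_classes_sum: "(\<And>i. i \<in> I \<Longrightarrow> f i \<in> Y_classes) \<Longrightarrow> (\<Sum>i\<in>I. f i) \<in> Y_classes"
  by (induction I rule: infinite_finite_induct) (auto intro: Y_classes_add)

lemma Y_classes_prod: "(\<And>i. i \<in> I \<Longrightarrow> f i \<in> Y_classes) \<Longrightarrow> (\<Prod>i\<in>I. f i) \<in> Y_classes"
  by (induction I rule: infinite_finite_induct) (auto intro: Y_classes_mult)

lemma Y_classes_of_nat [simp]: "of_nat k \<in> Y_classes"
  by (induction k) (auto intro: Y_classes_add)

lemma Y_classes_hyp: "\<alpha> > 0 \<Longrightarrow> hyp \<alpha> \<in> Y_classes"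
  by (simp add: Y_classes_def hyp_def lookup_single)

text \<open>No monomial of \<open>\<omega>\<close> contains H_0, so the exponent of H_0 in the
  product is exactly \<open>i\<close> and the rest can be read off separately.\<close>

lemma lookup_hyp_power_mult:
  assumes "\<omega> \<in> Y_classes" "Poly_Mapping.lookup T 0 = 0"
  shows "Poly_Mapping.lookup (hyp 0 ^ i * \<omega>) (Poly_Mapping.single 0 k + T)
    = (if i = k then Poly_Mapping.lookup \<omega> T else 0)"
proof -
  have "Poly_Mapping.lookup (hyp 0 ^ i * \<omega>) (Poly_Mapping.single 0 k + T)
      = (\<Sum>q. Poly_Mapping.lookup \<omega> q when Poly_Mapping.single 0 k + T = Poly_Mapping.single 0 i + q)"
    by (simp add: hyp_power lookup_mult lookup_single when_mult)
  also have "\<dots> = (\<Sum>q. (Poly_Mapping.lookup \<omega> q when i = k) when q = T)"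
  proof (rule arg_cong[where f = Sum_any], rule ext)
    fix q
    show "(Poly_Mapping.lookup \<omega> q when Poly_Mapping.single 0 k + T = Poly_Mapping.single 0 i + q)
      = ((Poly_Mapping.lookup \<omega> q when i = k) when q = T)"
    proof (cases "Poly_Mapping.lookup \<omega> q = 0")
      case False
      then have q: "Poly_Mapping.lookup q 0 = 0"
        using assms(1) by (simp add: Y_classes_def in_keys_iff)
      have "i = k" if "Poly_Mapping.single 0 k + T = Poly_Mapping.single 0 i + q"
        using arg_cong[OF that, of "\<lambda>m. Poly_Mapping.lookup m 0"] q assms(2) by (simp add: lookup_add)
      then show ?thesis
        by (auto simp: when_def)
    qed simp
  qed
  also have "\<dots> = (if i = k then Poly_Mapping.lookup \<omega> T else 0)"
    by simp
  finally show ?thesis .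
qed

section \<open>Integration over Y on monomials\<close>

lemma int_Y_add: "int_Y ns (\<omega> + \<eta>) = int_Y ns \<omega> + int_Y ns \<eta>"
  by (simp add: int_Y_def int_proj_prod_def lookup_add)

lemma int_Y_diff: "int_Y ns (\<omega> - \<eta>) = int_Y ns \<omega> - int_Y ns \<eta>"
  by (simp add: int_Y_def int_proj_prod_def lookup_minus)

lemma int_Y_sum: "int_Y ns (\<Sum>i\<in>I. f i) = (\<Sum>i\<in>I. int_Y ns (f i))"
  by (simp add: int_Y_def int_proj_prod_def lookup_sum)

lemma int_Y_of_nat: "int_Y ns (of_nat k * \<omega>) = of_nat k * int_Y ns \<omega>"
  by (induction k) (simp_all add: distrib_right int_Y_add, simp add: int_Y_def int_proj_prod_def)

lemma lookup_sum_list_single: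
  "Poly_Mapping.lookup (\<Sum>\<alpha>\<leftarrow>xs. Poly_Mapping.single \<alpha> 1) i = count_list xs i"
  by (induction xs) (auto simp: lookup_add lookup_single when_def)

lemma prod_list_hyp: "(\<Prod>\<alpha>\<leftarrow>xs. hyp \<alpha>) = Poly_Mapping.single (\<Sum>\<alpha>\<leftarrow>xs. Poly_Mapping.single \<alpha> 1) 1"
  by (induction xs) (simp_all add: hyp_def mult_single)

lemma int_Y_monomial:
  assumes "set xs \<subseteq> {1..length ns}"
  shows "int_Y ns (\<Prod>\<alpha>\<leftarrow>xs. hyp \<alpha>) = top_coeff ns xs"
proof -
  let ?T = "\<Sum>\<alpha>\<in>{1..length ns}. Poly_Mapping.single \<alpha> (n_comp ns \<alpha> - 1)"
  have T: "Poly_Mapping.lookup ?T i = (if i \<in> {1..length ns} then n_comp ns i - 1 else 0)" for i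
    by (simp add: lookup_sum lookup_single when_def)
  have "(\<Sum>\<alpha>\<leftarrow>xs. Poly_Mapping.single \<alpha> 1) = ?T
      \<longleftrightarrow> (\<forall>i. count_list xs i = (if i \<in> {1..length ns} then n_comp ns i - 1 else 0))"
    unfolding poly_mapping_eq_iff fun_eq_iff T lookup_sum_list_single ..
  also have "\<dots> \<longleftrightarrow> (\<forall>i\<in>{1..length ns}. count_list xs i = n_comp ns i - 1)"
    using assms by (auto simp: count_list_0_iff)
  also have "\<dots> \<longleftrightarrow> map (count_list xs) [1..<length ns + 1] = map (\<lambda>m. m - 1) ns"
  proof
    assume *: "\<forall>i\<in>{1..length ns}. count_list xs i = n_comp ns i - 1"
    show "map (count_list xs) [1..<length ns + 1] = map (\<lambda>m. m - 1) ns"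
      by (rule nth_equalityI) (use * in \<open>auto simp del: upt_Suc\<close>)
  next
    assume *: "map (count_list xs) [1..<length ns + 1] = map (\<lambda>m. m - 1) ns"
    show "\<forall>i\<in>{1..length ns}. count_list xs i = n_comp ns i - 1"
    proof
      fix i assume "i \<in> {1..length ns}"
      then show "count_list xs i = n_comp ns i - 1"
        using arg_cong[OF *, of "\<lambda>l. l ! (i - 1)"] by (auto simp del: upt_Suc)
    qed
  qed
  finally show ?thesis
    unfolding int_Y_def int_proj_prod_def prod_list_hyp by (simp add: lookup_single when_def top_coeff_def)
qed

text \<open>Newton's identity 2 e_2 = p_1^2 - p_2; it presents A_2 as a quadratic form with explicit
  coefficients.\<close>

lemma two_mult_esym_2:
  fixes f :: "nat \<Rightarrow> 'a :: comm_ring_1"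
  assumes "finite A"
  shows "2 * (\<Sum>S | S \<subseteq> A \<and> card S = 2. \<Prod>i\<in>S. f i) = (\<Sum>i\<in>A. f i)\<^sup>2 - (\<Sum>i\<in>A. (f i)\<^sup>2)"
  using assms
proof (induction A)
  case empty
  have none: "{S. S \<subseteq> ({} :: nat set) \<and> card S = 2} = {}"
    by auto
  show ?case
    unfolding none by simp
next
  case (insert x A)
  have sets: "{S. S \<subseteq> insert x A \<and> card S = 2} = {S. S \<subseteq> A \<and> card S = 2} \<union> (\<lambda>y. {x, y}) ` A"
    using insert.hyps by (auto simp: card_2_iff)
  have "(\<Sum>S | S \<subseteq> insert x A \<and> card S = 2. \<Prod>i\<in>S. f i)
      = (\<Sum>S | S \<subseteq> A \<and> card S = 2. \<Prod>i\<in>S. f i) + (\<Sum>S\<in>(\<lambda>y. {x, y}) ` A. \<Prod>i\<in>S. f i)"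
    unfolding sets using insert.hyps by (intro sum.union_disjoint) auto
  also have "(\<Sum>S\<in>(\<lambda>y. {x, y}) ` A. \<Prod>i\<in>S. f i) = (\<Sum>y\<in>A. \<Prod>i\<in>{x, y}. f i)"
    by (rule sum.reindex_cong[of "\<lambda>y. {x, y}"]) (auto simp: inj_on_def doubleton_eq_iff)
  also have "\<dots> = f x * (\<Sum>y\<in>A. f y)"
    unfolding sum_distrib_left
  proof (rule sum.cong)
    fix y assume "y \<in> A"
    then have "x \<noteq> y"
      using insert.hyps by auto
    then show "(\<Prod>i\<in>{x, y}. f i) = f x * f y"
      by simp
  qed simp
  finally show ?case
    using insert by (simp add: distrib_left power2_eq_square algebra_simps)
qed

lemma set_upt_list: "set [1..<r + 1] = {1..r}"
  by auto

lemma sum_upt_list: "(\<Sum>\<alpha>\<leftarrow>[1..<r + 1]. f \<alpha>) = (\<Sum>\<alpha>\<in>{1..r}. f \<alpha>)"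
  by (simp add: sum_list_distinct_conv_sum_set atLeastLessThanSuc_atLeastAtMost del: upt_Suc)

section \<open>Second Chern classes through the additive Chern character\<close>

lemma fps_mult_nth_1: "fps_nth (f * g) 1 = fps_nth f 0 * fps_nth g 1 + fps_nth f 1 * fps_nth g 0"
  by (simp add: fps_mult_nth)

lemma fps_mult_nth_2:
  "fps_nth (f * g) 2 = fps_nth f 0 * fps_nth g 2 + fps_nth f 1 * fps_nth g 1 + fps_nth f 2 * fps_nth g 0"
  by (simp add: fps_mult_nth numeral_2_eq_2 algebra_simps)

text \<open>
  For a total Chern class \<open>f\<close> this is \<open>2 ch\<^sub>2\<close>; the Chern character is additive in short exact sequences.
\<close>

definition two_ch2 :: "'a :: comm_ring_1 fps \<Rightarrow> 'a" where
  "two_ch2 f = (fps_nth f 1)\<^sup>2 - 2 * fps_nth f 2"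

text \<open>Recording c_1 and 2 ch_2 turns products of total Chern classes into sums, and the factor
  2 avoids division in the class ring.\<close>

definition total_chern :: "'a :: comm_ring_1 fps \<Rightarrow> 'a \<Rightarrow> 'a \<Rightarrow> bool" where
  "total_chern f a b \<longleftrightarrow> fps_nth f 0 = 1 \<and> fps_nth f 1 = a \<and> two_ch2 f = b"

lemma total_chern_mult: "total_chern f a b \<Longrightarrow> total_chern g a' b' \<Longrightarrow> total_chern (f * g) (a + a') (b + b')"
  unfolding total_chern_def two_ch2_def fps_mult_nth_1 fps_mult_nth_2 fps_mult_nth_0
  by (auto simp: power2_eq_square algebra_simps)

lemma total_chern_1: "total_chern 1 0 0"
  by (simp add: total_chern_def two_ch2_def)

lemma total_chern_line: "total_chern (1 + fps_const a * fps_X) a (a\<^sup>2)"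
  by (simp add: total_chern_def two_ch2_def)

lemma total_chern_power: "total_chern f a b \<Longrightarrow> total_chern (f ^ k) (of_nat k * a) (of_nat k * b)"
  by (induction k) (auto simp: algebra_simps intro: total_chern_1 dest: total_chern_mult)

lemma total_chern_prod:
  "(\<And>i. i \<in> I \<Longrightarrow> total_chern (f i) (a i) (b i)) \<Longrightarrow> total_chern (\<Prod>i\<in>I. f i) (\<Sum>i\<in>I. a i) (\<Sum>i\<in>I. b i)"
  by (induction I rule: infinite_finite_induct) (auto intro: total_chern_1 total_chern_mult)

section \<open>Pushing intersection numbers from X down to Y\<close>

locale splitting =
  fixes ns :: "nat list" and n :: nat and nI :: "nat \<Rightarrow> nat \<Rightarrow> nat"
  assumes splitting: "splitting_configuration ns n nI"
begin

abbreviation A :: "nat \<Rightarrow> cls" where "A \<equiv> esym ns n nI"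
abbreviation Y where "Y \<equiv> {1..length ns}"

lemma nH_Y: "nH ns nI I \<in> Y_classes"
  unfolding nH_def by (intro Y_classes_sum Y_classes_mult Y_classes_of_nat Y_classes_hyp) auto

lemma A_Y: "A k \<in> Y_classes"
  unfolding esym_def by (intro Y_classes_sum Y_classes_prod nH_Y)

text \<open>The push-forward of H_0^j [X] to Y is A_{j+1}: when the product over the n + 1
  hypersurfaces is expanded, H_0 must be chosen n - j times, which leaves j + 1 factors
  n_I(H).\<close>

lemma int_X_hyp_power:
  assumes "\<omega> \<in> Y_classes"
  shows "int_X ns n nI (hyp 0 ^ j * \<omega>) = int_Y ns (\<omega> * A (j + 1))"
proof -
  let ?I = "{1..n+1}"
  let ?T = "\<Sum>\<alpha>\<in>Y. Poly_Mapping.single \<alpha> (n_comp ns \<alpha> - 1)"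
  have Y: "{0..length ns} = insert 0 Y"
    by auto
  have top: "(\<Sum>\<alpha>\<in>{0..length ns}. Poly_Mapping.single \<alpha> (if \<alpha> = 0 then n else n_comp ns \<alpha> - 1))
      = Poly_Mapping.single 0 n + ?T"
    unfolding Y by (subst sum.insert) (auto intro!: sum.cong)
  have T0: "Poly_Mapping.lookup ?T 0 = 0"
    by (simp add: lookup_sum lookup_single)
  have "hyp 0 ^ j * \<omega> * (\<Prod>I\<in>?I. hyp 0 + nH ns nI I)
      = (\<Sum>X\<in>Pow ?I. hyp 0 ^ (j + card X) * (\<omega> * (\<Prod>I\<in>?I - X. nH ns nI I)))"
    unfolding prod_add[OF finite_atLeastAtMost] sum_distrib_left
    by (intro sum.cong) (simp_all add: power_add mult_ac)
  moreover have "Poly_Mapping.lookup (hyp 0 ^ (j + card X) * (\<omega> * (\<Prod>I\<in>?I - X. nH ns nI I))) (Poly_Mapping.single 0 n + ?T)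
      = (if j + card X = n then int_Y ns (\<omega> * (\<Prod>I\<in>?I - X. nH ns nI I)) else 0)" for X
    unfolding lookup_hyp_power_mult[OF Y_classes_mult[OF assms Y_classes_prod[OF nH_Y]] T0]
    by (simp only: int_Y_def int_proj_prod_def)
  ultimately have "int_X ns n nI (hyp 0 ^ j * \<omega>)
      = (\<Sum>X\<in>Pow ?I. if j + card X = n then int_Y ns (\<omega> * (\<Prod>I\<in>?I - X. nH ns nI I)) else 0)"
    unfolding int_X_def int_ambient_def int_proj_prod_def top
    by (simp only: lookup_sum)
  also have "\<dots> = (\<Sum>X\<in>{X \<in> Pow ?I. j + card X = n}. int_Y ns (\<omega> * (\<Prod>I\<in>?I - X. nH ns nI I)))"
    by (rule sum.inter_filter[symmetric]) simp
  also have "\<dots> = (\<Sum>S | S \<subseteq> ?I \<and> card S = j + 1. int_Y ns (\<omega> * (\<Prod>I\<in>S. nH ns nI I)))"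
  proof (rule sum.reindex_bij_witness[of _ "\<lambda>S. ?I - S" "\<lambda>X. ?I - X"])
    fix X assume X: "X \<in> {X \<in> Pow ?I. j + card X = n}"
    then have "card (?I - X) = n + 1 - card X"
      by (subst card_Diff_subset) (auto intro: finite_subset)
    then show "?I - X \<in> {S. S \<subseteq> ?I \<and> card S = j + 1}"
      using X by auto
  next
    fix S assume S: "S \<in> {S. S \<subseteq> ?I \<and> card S = j + 1}"
    then have "card (?I - S) = n + 1 - card S" "card S \<le> n + 1"
      using card_mono[of ?I S] by (auto simp: card_Diff_subset finite_subset)
    then show "?I - S \<in> {X \<in> Pow ?I. j + card X = n}"
      using S by auto
  qed auto
  also have "\<dots> = int_Y ns (\<omega> * A (j + 1))"
    by (simp add: esym_def int_Y_sum sum_distrib_left)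
  finally show ?thesis .
qed

lemma int_X_Y: "\<omega> \<in> Y_classes \<Longrightarrow> int_X ns n nI \<omega> = int_Y ns (\<omega> * A 1)"
  using int_X_hyp_power[of \<omega> 0] by simp

lemma int_X_hyp: "\<omega> \<in> Y_classes \<Longrightarrow> int_X ns n nI (hyp 0 * \<omega>) = int_Y ns (\<omega> * A 2)"
  using int_X_hyp_power[of \<omega> 1] by (simp add: numeral_2_eq_2)

lemma int_X_hyp_hyp: "\<omega> \<in> Y_classes \<Longrightarrow> int_X ns n nI (hyp 0 * hyp 0 * \<omega>) = int_Y ns (\<omega> * A 3)"
  using int_X_hyp_power[of \<omega> 2] by (simp add: numeral_3_eq_3 power2_eq_square)

lemma sum_nH: "(\<Sum>I=1..n+1. nH ns nI I) = A 1"
proof -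
  have "{S. S \<subseteq> {1..n+1} \<and> card S = 1} = (\<lambda>I. {I}) ` {1..n+1}"
    by (auto simp: card_1_singleton_iff)
  then show ?thesis
    unfolding esym_def by (simp add: sum.reindex)
qed

lemma A_1: "A 1 = (\<Sum>\<alpha>\<in>Y. of_nat (n_comp ns \<alpha>) * hyp \<alpha>)"
proof -
  have "A 1 = (\<Sum>I=1..n+1. nH ns nI I)"
    by (rule sum_nH[symmetric])
  also have "\<dots> = (\<Sum>\<alpha>\<in>Y. \<Sum>I=1..n+1. of_nat (nI I \<alpha>) * hyp \<alpha>)"
    unfolding nH_def by (rule sum.swap)
  also have "\<dots> = (\<Sum>\<alpha>\<in>Y. of_nat (n_comp ns \<alpha>) * hyp \<alpha>)"
  proof (rule sum.cong)
    fix \<alpha> assume "\<alpha> \<in> Y"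
    then have "(\<Sum>I=1..n+1. nI I \<alpha>) = n_comp ns \<alpha>"
      using splitting by (simp add: splitting_configuration_def)
    then show "(\<Sum>I=1..n+1. of_nat (nI I \<alpha>) * hyp \<alpha>) = of_nat (n_comp ns \<alpha>) * hyp \<alpha>"
      by (metis of_nat_sum sum_distrib_right)
  qed simp
  finally show ?thesis .
qed

lemma two_A_2: "2 * A 2 = (A 1)\<^sup>2 - (\<Sum>I=1..n+1. (nH ns nI I)\<^sup>2)"
  unfolding sum_nH[symmetric] by (subst esym_def, rule two_mult_esym_2) simp

lemma int_Y_linear:
  "int_Y ns (\<omega> * (\<Sum>\<alpha>\<in>Y. of_nat (k \<alpha>) * hyp \<alpha>)) = (\<Sum>\<alpha>\<in>Y. of_nat (k \<alpha>) * int_Y ns (\<omega> * hyp \<alpha>))"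
  by (simp add: sum_distrib_left int_Y_sum mult.left_commute[of \<omega>] int_Y_of_nat)

lemma int_Y_square:
  "int_Y ns (\<omega> * (\<Sum>\<alpha>\<in>Y. of_nat (k \<alpha>) * hyp \<alpha>)\<^sup>2)
     = (\<Sum>\<gamma>\<in>Y. \<Sum>\<delta>\<in>Y. of_nat (k \<gamma>) * of_nat (k \<delta>) * int_Y ns (\<omega> * hyp \<gamma> * hyp \<delta>))"
proof -
  have "int_Y ns (\<omega> * (\<Sum>\<alpha>\<in>Y. of_nat (k \<alpha>) * hyp \<alpha>)\<^sup>2)
      = int_Y ns (\<omega> * (\<Sum>\<alpha>\<in>Y. of_nat (k \<alpha>) * hyp \<alpha>) * (\<Sum>\<alpha>\<in>Y. of_nat (k \<alpha>) * hyp \<alpha>))"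
    by (simp only: power2_eq_square mult.assoc)
  also have "\<dots> = (\<Sum>\<gamma>\<in>Y. of_nat (k \<gamma>) * int_Y ns (\<omega> * (\<Sum>\<alpha>\<in>Y. of_nat (k \<alpha>) * hyp \<alpha>) * hyp \<gamma>))"
    by (rule int_Y_linear)
  also have "\<dots> = (\<Sum>\<gamma>\<in>Y. of_nat (k \<gamma>) * int_Y ns (\<omega> * hyp \<gamma> * (\<Sum>\<alpha>\<in>Y. of_nat (k \<alpha>) * hyp \<alpha>)))"
    by (intro sum.cong refl) (simp only: mult_ac)
  also have "\<dots> = (\<Sum>\<gamma>\<in>Y. \<Sum>\<delta>\<in>Y. of_nat (k \<gamma>) * of_nat (k \<delta>) * int_Y ns (\<omega> * hyp \<gamma> * hyp \<delta>))"
    unfolding int_Y_linear by (simp add: sum_distrib_left mult.assoc)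
  finally show ?thesis .
qed

text \<open>The symmetric coefficient matrix of A_2 = (A_1^2 - \<Sum> n_I(H)^2) / 2, diagonal
  included.\<close>

definition quadratic_coeff :: "nat \<Rightarrow> nat \<Rightarrow> rat" where
  "quadratic_coeff \<gamma> \<delta> = (of_nat (n_comp ns \<gamma> * n_comp ns \<delta>) - (\<Sum>I=1..n+1. of_nat (nI I \<gamma> * nI I \<delta>))) / 2"

lemma int_Y_A_2: "int_Y ns (\<omega> * A 2) = (\<Sum>\<gamma>\<in>Y. \<Sum>\<delta>\<in>Y. quadratic_coeff \<gamma> \<delta> * int_Y ns (\<omega> * hyp \<gamma> * hyp \<delta>))"
proof -
  have "2 * int_Y ns (\<omega> * A 2) = int_Y ns (\<omega> * (2 * A 2))"
    using int_Y_of_nat[of ns 2 "\<omega> * A 2"] by (simp add: mult_ac)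
  also have "\<dots> = int_Y ns (\<omega> * (A 1)\<^sup>2) - (\<Sum>I=1..n+1. int_Y ns (\<omega> * (nH ns nI I)\<^sup>2))"
    unfolding two_A_2 right_diff_distrib int_Y_diff sum_distrib_left int_Y_sum ..
  also have "\<dots> = (\<Sum>\<gamma>\<in>Y. \<Sum>\<delta>\<in>Y. of_nat (n_comp ns \<gamma>) * of_nat (n_comp ns \<delta>) * int_Y ns (\<omega> * hyp \<gamma> * hyp \<delta>))
      - (\<Sum>I=1..n+1. \<Sum>\<gamma>\<in>Y. \<Sum>\<delta>\<in>Y. of_nat (nI I \<gamma>) * of_nat (nI I \<delta>) * int_Y ns (\<omega> * hyp \<gamma> * hyp \<delta>))"
    unfolding A_1 nH_def int_Y_square ..
  also have "(\<Sum>I=1..n+1. \<Sum>\<gamma>\<in>Y. \<Sum>\<delta>\<in>Y. of_nat (nI I \<gamma>) * of_nat (nI I \<delta>) * int_Y ns (\<omega> * hyp \<gamma> * hyp \<delta>))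
      = (\<Sum>\<gamma>\<in>Y. \<Sum>I=1..n+1. \<Sum>\<delta>\<in>Y. of_nat (nI I \<gamma>) * of_nat (nI I \<delta>) * int_Y ns (\<omega> * hyp \<gamma> * hyp \<delta>))"
    by (rule sum.swap)
  also have "\<dots> = (\<Sum>\<gamma>\<in>Y. \<Sum>\<delta>\<in>Y. (\<Sum>I=1..n+1. of_nat (nI I \<gamma> * nI I \<delta>)) * int_Y ns (\<omega> * hyp \<gamma> * hyp \<delta>))"
    unfolding sum_distrib_right of_nat_mult by (intro sum.cong refl sum.swap)
  also have "(\<Sum>\<gamma>\<in>Y. \<Sum>\<delta>\<in>Y. of_nat (n_comp ns \<gamma>) * of_nat (n_comp ns \<delta>) * int_Y ns (\<omega> * hyp \<gamma> * hyp \<delta>)) - \<dots>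
      = 2 * (\<Sum>\<gamma>\<in>Y. \<Sum>\<delta>\<in>Y. quadratic_coeff \<gamma> \<delta> * int_Y ns (\<omega> * hyp \<gamma> * hyp \<delta>))"
    unfolding quadratic_coeff_def sum_subtractf[symmetric] sum_distrib_left
    by (intro sum.cong refl) (simp add: left_diff_distrib)
  finally show ?thesis
    by simp
qed

lemma int_Y_hyps:
  assumes "\<alpha> \<in> Y" "\<beta> \<in> Y" "\<gamma> \<in> Y" "\<delta> \<in> Y"
  shows "int_Y ns (hyp \<alpha> * hyp \<beta> * hyp \<gamma> * hyp \<delta>) = top_coeff ns [\<alpha>, \<beta>, \<gamma>, \<delta>]"
  using int_Y_monomial[of "[\<alpha>, \<beta>, \<gamma>, \<delta>]" ns] assms by (simp add: mult.assoc)

lemma c3_num_Y: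
  assumes "\<alpha> \<in> Y" "\<beta> \<in> Y" "\<gamma> \<in> Y"
  shows "c3_num ns n nI \<alpha> \<beta> \<gamma> = (\<Sum>\<delta>\<in>Y. of_nat (n_comp ns \<delta>) * top_coeff ns [\<alpha>, \<beta>, \<gamma>, \<delta>])"
proof -
  have "c3_num ns n nI \<alpha> \<beta> \<gamma> = int_Y ns (hyp \<alpha> * hyp \<beta> * hyp \<gamma> * A 1)"
    unfolding c3_num_def using assms by (intro int_X_Y Y_classes_mult Y_classes_hyp) auto
  then show ?thesis
    unfolding A_1 int_Y_linear using assms by (simp add: int_Y_hyps)
qed

lemma c3_num_0: "\<alpha> \<in> Y \<Longrightarrow> \<beta> \<in> Y \<Longrightarrow> c3_num ns n nI 0 \<alpha> \<beta> = int_Y ns (hyp \<alpha> * hyp \<beta> * A 2)"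
  using int_X_hyp[of "hyp \<alpha> * hyp \<beta>"] by (simp add: c3_num_def Y_classes_mult Y_classes_hyp mult.assoc)

lemma c3_num_0_eq:
  assumes "\<alpha> \<in> Y" "\<beta> \<in> Y"
  shows "c3_num ns n nI 0 \<alpha> \<beta> = (\<Sum>\<gamma>\<in>Y. \<Sum>\<delta>\<in>Y. quadratic_coeff \<gamma> \<delta> * top_coeff ns [\<alpha>, \<beta>, \<gamma>, \<delta>])"
  unfolding c3_num_0[OF assms] int_Y_A_2 using assms by (simp add: int_Y_hyps)

lemma c3_num_0_0: "\<alpha> \<in> Y \<Longrightarrow> c3_num ns n nI 0 0 \<alpha> = int_Y ns (hyp \<alpha> * A 3)"
  using int_X_hyp_hyp[of "hyp \<alpha>"] by (simp add: c3_num_def Y_classes_hyp)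

text \<open>One factor of each product is expanded in the hyperplane classes, A_2 by
  \<open>quadratic_coeff\<close> and A_1 by the n^(\<delta>); the remaining A_2 or A_3 is absorbed
  as H_0 or H_0^2 on X.\<close>

lemma N_num_eq:
  "N_num ns n nI = (\<Sum>\<gamma>\<in>Y. \<Sum>\<delta>\<in>Y. quadratic_coeff \<gamma> \<delta> * c3_num ns n nI 0 \<gamma> \<delta>)
     - (\<Sum>\<delta>\<in>Y. of_nat (n_comp ns \<delta>) * c3_num ns n nI 0 0 \<delta>)"
proof -
  have "N_num ns n nI = int_Y ns (A 2 * A 2) - int_Y ns (A 3 * A 1)"
    by (simp add: N_num_def int_Y_diff power2_eq_square mult.commute)
  also have "int_Y ns (A 2 * A 2) = (\<Sum>\<gamma>\<in>Y. \<Sum>\<delta>\<in>Y. quadratic_coeff \<gamma> \<delta> * c3_num ns n nI 0 \<gamma> \<delta>)"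
    unfolding int_Y_A_2 by (intro sum.cong refl) (simp add: c3_num_0 mult_ac)
  also have "int_Y ns (A 3 * A 1) = (\<Sum>\<delta>\<in>Y. of_nat (n_comp ns \<delta>) * c3_num ns n nI 0 0 \<delta>)"
    unfolding A_1 int_Y_linear by (intro sum.cong refl) (simp add: c3_num_0_0 mult.commute)
  finally show ?thesis .
qed

text \<open>The ambient and normal bundles have the same c_1, so c_1(X) = 0 and 2 c_2(X) is the 2
  ch_2 of the normal bundle minus that of the ambient one; the H_0^2 terms cancel.\<close>

lemma two_c2:
  "2 * fps_nth (chern_X ns n nI) 2
     = 2 * (hyp 0 * A 1) + ((A 1)\<^sup>2 - 2 * A 2 - (\<Sum>\<alpha>\<in>Y. of_nat (n_comp ns \<alpha>) * (hyp \<alpha>)\<^sup>2))"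
proof -
  let ?S = "\<Sum>\<alpha>\<in>Y. of_nat (n_comp ns \<alpha>) * (hyp \<alpha>)\<^sup>2"
  have amb: "total_chern (chern_ambient ns n) (of_nat (n + 1) * hyp 0 + A 1) (of_nat (n + 1) * (hyp 0)\<^sup>2 + ?S)"
    unfolding chern_ambient_def A_1
    by (intro total_chern_mult total_chern_prod total_chern_power total_chern_line)
  have "total_chern (chern_normal ns n nI) (\<Sum>I=1..n+1. hyp 0 + nH ns nI I) (\<Sum>I=1..n+1. (hyp 0 + nH ns nI I)\<^sup>2)"
    unfolding chern_normal_def by (intro total_chern_prod total_chern_line)
  also have "(\<Sum>I=1..n+1. hyp 0 + nH ns nI I) = of_nat (n + 1) * hyp 0 + A 1"
    by (simp only: sum.distrib sum_nH) simp
  also have "(\<Sum>I=1..n+1. (hyp 0 + nH ns nI I)\<^sup>2)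
      = of_nat (n + 1) * (hyp 0)\<^sup>2 + 2 * (hyp 0 * A 1) + (\<Sum>I=1..n+1. (nH ns nI I)\<^sup>2)"
    unfolding sum_nH[symmetric] sum_distrib_left power2_sum
    by (simp add: sum.distrib algebra_simps)
  also have "(\<Sum>I=1..n+1. (nH ns nI I)\<^sup>2) = (A 1)\<^sup>2 - 2 * A 2"
    using two_A_2 by simp
  finally have normal: "total_chern (chern_normal ns n nI) (of_nat (n + 1) * hyp 0 + A 1)
      (of_nat (n + 1) * (hyp 0)\<^sup>2 + 2 * (hyp 0 * A 1) + ((A 1)\<^sup>2 - 2 * A 2))" .
  let ?c = "fps_nth (chern_X ns n nI)"
  have "?c 0 = 1"
    using arg_cong[OF chern_X_mult_chern_normal[of ns n nI], of "\<lambda>f. fps_nth f 0"] amb normal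
    by (simp add: total_chern_def)
  then have "total_chern (chern_X ns n nI) (?c 1) (two_ch2 (chern_X ns n nI))"
    by (simp add: total_chern_def)
  from total_chern_mult[OF this normal] have
    "?c 1 + (of_nat (n + 1) * hyp 0 + A 1) = of_nat (n + 1) * hyp 0 + A 1"
    "two_ch2 (chern_X ns n nI) + (of_nat (n + 1) * (hyp 0)\<^sup>2 + 2 * (hyp 0 * A 1) + ((A 1)\<^sup>2 - 2 * A 2))
      = of_nat (n + 1) * (hyp 0)\<^sup>2 + ?S"
    using amb unfolding chern_X_mult_chern_normal total_chern_def by simp_all
  then show ?thesis
    by (simp add: two_ch2_def algebra_simps)
qed

lemma int_X_add: "int_X ns n nI (\<omega> + \<eta>) = int_X ns n nI \<omega> + int_X ns n nI \<eta>"
  by (simp add: int_X_def int_ambient_def int_proj_prod_def distrib_right lookup_add)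

text \<open>In twice the integral of c_2 H_\<alpha>, the term 2 H_0 A_1 pushes forward to 2 A_1 A_2
  and cancels -2 A_2 against the class A_1 of the push-forward of X. Hence l_\<alpha> for \<alpha>
  \<ge> 1 does not depend on the splitting.\<close>

lemma l_num_Y:
  assumes "\<alpha> \<in> Y"
  shows "l_num ns n nI \<alpha> = c3_num ns n nI \<alpha> \<alpha> \<alpha> / 6
      + ((\<Sum>\<beta>\<in>Y. \<Sum>\<gamma>\<in>Y. \<Sum>\<delta>\<in>Y. of_nat (n_comp ns \<beta> * n_comp ns \<gamma> * n_comp ns \<delta>) * top_coeff ns [\<alpha>, \<beta>, \<gamma>, \<delta>])
         - (\<Sum>\<beta>\<in>Y. \<Sum>\<gamma>\<in>Y. of_nat (n_comp ns \<beta> * n_comp ns \<gamma>) * top_coeff ns [\<alpha>, \<beta>, \<beta>, \<gamma>])) / 24"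
proof -
  let ?S = "\<Sum>\<alpha>\<in>Y. of_nat (n_comp ns \<alpha>) * (hyp \<alpha>)\<^sup>2" and ?c2 = "fps_nth (chern_X ns n nI) 2"
  have hyp: "hyp \<alpha> \<in> Y_classes"
    using assms by (intro Y_classes_hyp) auto
  have S: "?S \<in> Y_classes"
    unfolding power2_eq_square by (intro Y_classes_sum Y_classes_mult Y_classes_hyp) auto
  have "2 * int_X ns n nI (?c2 * hyp \<alpha>) = int_X ns n nI ((2 * ?c2) * hyp \<alpha>)"
    unfolding mult_2 distrib_right int_X_add ..
  also have "(2 * ?c2) * hyp \<alpha> = hyp 0 * (A 1 * hyp \<alpha>) + (hyp 0 * (A 1 * hyp \<alpha>) + ((A 1)\<^sup>2 - 2 * A 2 - ?S) * hyp \<alpha>)"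
    unfolding two_c2 by (simp add: algebra_simps)
  also have "int_X ns n nI \<dots> = 2 * int_Y ns (A 1 * hyp \<alpha> * A 2) + int_Y ns (((A 1)\<^sup>2 - 2 * A 2 - ?S) * hyp \<alpha> * A 1)"
  proof -
    have "(A 1)\<^sup>2 - 2 * A 2 = (\<Sum>I=1..n+1. (nH ns nI I)\<^sup>2)"
      using two_A_2 by simp
    moreover have "\<dots> \<in> Y_classes"
      unfolding power2_eq_square by (intro Y_classes_sum Y_classes_mult nH_Y)
    moreover have "- ?S \<in> Y_classes"
      using S by (simp add: Y_classes_def)
    ultimately have ch2: "(A 1)\<^sup>2 - 2 * A 2 - ?S \<in> Y_classes"
      using Y_classes_add[of "(A 1)\<^sup>2 - 2 * A 2" "- ?S"] by simp
    show ?thesis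
      unfolding int_X_add int_X_hyp[OF Y_classes_mult[OF A_Y hyp]] int_X_Y[OF Y_classes_mult[OF ch2 hyp]]
      by simp
  qed
  also have "int_Y ns (((A 1)\<^sup>2 - 2 * A 2 - ?S) * hyp \<alpha> * A 1)
      = int_Y ns (hyp \<alpha> * A 1 * (A 1)\<^sup>2) - 2 * int_Y ns (A 1 * hyp \<alpha> * A 2) - int_Y ns (hyp \<alpha> * ?S * A 1)"
  proof -
    have "((A 1)\<^sup>2 - 2 * A 2 - ?S) * hyp \<alpha> * A 1
        = hyp \<alpha> * A 1 * (A 1)\<^sup>2 - of_nat 2 * (A 1 * hyp \<alpha> * A 2) - hyp \<alpha> * ?S * A 1"
      by (simp add: algebra_simps)
    then show ?thesis
      using int_Y_of_nat[of ns 2 "A 1 * hyp \<alpha> * A 2"] by (simp only: int_Y_diff of_nat_numeral)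
  qed
  also have "int_Y ns (hyp \<alpha> * A 1 * (A 1)\<^sup>2)
      = (\<Sum>\<beta>\<in>Y. \<Sum>\<gamma>\<in>Y. \<Sum>\<delta>\<in>Y. of_nat (n_comp ns \<beta> * n_comp ns \<gamma> * n_comp ns \<delta>) * top_coeff ns [\<alpha>, \<beta>, \<gamma>, \<delta>])"
  proof -
    have "int_Y ns (hyp \<alpha> * A 1 * (A 1)\<^sup>2) = int_Y ns (hyp \<alpha> * (A 1)\<^sup>2 * A 1)"
      by (simp add: mult_ac)
    also have "\<dots> = (\<Sum>\<beta>\<in>Y. of_nat (n_comp ns \<beta>) * int_Y ns (hyp \<alpha> * hyp \<beta> * (A 1)\<^sup>2))"
      unfolding A_1 by (subst int_Y_linear) (simp add: mult_ac)
    also have "\<dots> = (\<Sum>\<beta>\<in>Y. of_nat (n_comp ns \<beta>) *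
        (\<Sum>\<gamma>\<in>Y. \<Sum>\<delta>\<in>Y. of_nat (n_comp ns \<gamma>) * of_nat (n_comp ns \<delta>) * top_coeff ns [\<alpha>, \<beta>, \<gamma>, \<delta>]))"
      unfolding A_1 int_Y_square using assms by (intro sum.cong refl arg_cong[where f = "\<lambda>t. _ * t"]) (simp add: int_Y_hyps)
    finally show ?thesis
      by (simp add: sum_distrib_left mult_ac)
  qed
  also have "int_Y ns (hyp \<alpha> * ?S * A 1)
      = (\<Sum>\<beta>\<in>Y. \<Sum>\<gamma>\<in>Y. of_nat (n_comp ns \<beta> * n_comp ns \<gamma>) * top_coeff ns [\<alpha>, \<beta>, \<beta>, \<gamma>])"
  proof -
    have eq: "hyp \<alpha> * ?S * A 1 = (\<Sum>\<beta>\<in>Y. of_nat (n_comp ns \<beta>) * (hyp \<alpha> * hyp \<beta> * hyp \<beta> * A 1))"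
      by (simp add: sum_distrib_left sum_distrib_right power2_eq_square mult_ac)
    show ?thesis
      unfolding eq int_Y_sum int_Y_of_nat unfolding A_1 int_Y_linear
      using assms by (simp add: int_Y_hyps) (simp add: sum_distrib_left mult.assoc)
  qed
  finally show ?thesis
    by (simp add: l_num_def c_num_def)
qed

end

sublocale splitting \<subseteq> splitting_numbers ns "c3_num ns n nI" "l_num ns n nI" quadratic_coeff "N_num ns n nI"
proof unfold_locales
  show "c3_num ns n nI \<alpha> \<beta> \<gamma> = c3_num ns n nI \<beta> \<alpha> \<gamma>" "c3_num ns n nI \<alpha> \<beta> \<gamma> = c3_num ns n nI \<alpha> \<gamma> \<beta>" for \<alpha> \<beta> \<gamma>
    by (rule c3_num_swap)+
  show "quadratic_coeff \<alpha> \<beta> = quadratic_coeff \<beta> \<alpha>" for \<alpha> \<beta>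
    by (simp add: quadratic_coeff_def mult.commute)
qed (unfold sum_upt_list set_upt_list, (rule c3_num_Y c3_num_0_eq l_num_Y N_num_eq; assumption)+)

lemma (in splitting_numbers) box_kernel_factors:
  "box_kernel (factors ns 0) 0 0 x y
     = box_sum 0 ns (\<lambda>u w. line_twist (length ns) c u x Lab_O * euler_twist w y)"
proof -
  have "factors ns 0 = map (\<lambda>k. (ns ! k, Suc (0 + k))) [0..<length ns]"
    by (simp add: factors_def map_Suc_upt[symmetric] comp_def del: upt_Suc)
  then show ?thesis
    using box_kernel_eq_box_sum[of 0 0 0 ns x y] by simp
qed

text \<open>Choosing the head and removing it once lets the simplifier enumerate the orderings of an
  explicit list recursively.\<close>

lemma mset_eq_mset_Cons_iff:
  "mset ns = mset (m # ms)
    \<longleftrightarrow> (\<exists>x\<in>set (m # ms). \<exists>ns'. ns = x # ns' \<and> mset ns' = mset (remove1 x (m # ms)))" (is "_ = ?rhs")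
proof
  assume *: "mset ns = mset (m # ms)"
  then obtain x ns' where ns: "ns = x # ns'"
    by (cases ns) auto
  have "set ns = set (m # ms)" "mset (remove1 x ns) = mset (remove1 x (m # ms))"
    using mset_eq_setD[OF *] * by (simp_all only: mset_remove1)
  then show ?rhs
    using ns by auto
next
  assume ?rhs
  then obtain x ns' where "x \<in> set (m # ms)" "ns = x # ns'" "mset ns' = mset (remove1 x (m # ms))"
    by blast
  then show "mset ns = mset (m # ms)"
    by (simp only: mset.simps(2) mset_remove1 set_mset_mset[symmetric] insert_DiffM)
qed

lemma mset_in_cases:
  assumes "mset ns \<in> mset ` {[5], [3, 3], [4, 2], [3, 2, 2], [2, 2, 2, 2]}"
  shows "ns \<in> {[5], [3, 3], [4, 2], [2, 4], [3, 2, 2], [2, 3, 2], [2, 2, 3], [2, 2, 2, 2 :: nat]}"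
  using assms
  by (simp add: mset_eq_mset_Cons_iff del: mset.simps(2)) auto

lemma (in splitting_numbers) box_identity_beilinson:
  assumes "ns \<in> {[5], [3, 3], [4, 2], [2, 4], [3, 2, 2], [2, 3, 2], [2, 2, 3], [2, 2, 2, 2]}"
  shows "box_identity \<and> beilinson (factors ns 0)"
proof -
  from assms consider "ns = [5]" | "ns = [3, 3]" | "ns = [4, 2]" | "ns = [2, 4]" | "ns = [3, 2, 2]"
    | "ns = [2, 3, 2]" | "ns = [2, 2, 3]" | "ns = [2, 2, 2, 2]"
    unfolding insert_iff empty_iff by metis
  then show ?thesis
    by cases (intro conjI box_identity_beilinson_5 box_identity_beilinson_33 box_identity_beilinson_42
        box_identity_beilinson_24 box_identity_beilinson_322 box_identity_beilinson_232
        box_identity_beilinson_223 box_identity_beilinson_2222; assumption)+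
qed

theorem theorem5p1:
  fixes ns :: "nat list" and n :: nat and nI :: "nat \<Rightarrow> nat \<Rightarrow> nat"
  assumes "mset ns \<in> mset ` {[5], [3, 3], [4, 2], [3, 2, 2], [2, 2, 2, 2]}"
    and "splitting_configuration ns n nI"
  shows "M_mat ns n nI 0 * ordered_prod (length ns) (\<lambda>\<alpha>. L_mat ns n nI \<alpha> ^\<^sub>m n_comp ns \<alpha>)
           = T_N_mat ns n nI
       \<and> M_mat ns n nI 0
           = T_N_mat ns n nI
             * ordered_prod (length ns) (\<lambda>\<alpha>. inv_mat (L_mat ns n nI \<alpha>) ^\<^sub>m n_comp ns \<alpha>)
       \<and> (\<forall>\<alpha>\<in>{1..length ns}.
            (M_mat ns n nI \<alpha> * L_mat ns n nI \<alpha>) ^\<^sub>m n_comp ns \<alpha>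
              = (L_mat ns n nI \<alpha> * M_mat ns n nI \<alpha>) ^\<^sub>m n_comp ns \<alpha>)"
proof -
  interpret splitting ns n nI
    by unfold_locales (rule assms(2))
  have numbers: "box_identity" "beilinson (factors ns 0)"
    using box_identity_beilinson[OF mset_in_cases[OF assms(1)]] by simp_all
  have "box_kernel (factors ns 0) 0 0 x y
      = line_twist (length ns) (c3_num ns n nI) (- anticanonical ns) x y - delta x y
        - (if x = Lab_C 0 \<and> y = Lab_D 0 then N_num ns n nI else 0)"
    if "x \<in> set (labels (length ns))" "y \<in> set (labels (length ns))" for x y
    using numbers(1) that unfolding box_kernel_factors box_identity_def by blast
  note window = window.window_monodromy[OF numbers(2) this]
  show ?thesis
    using window by blast
qed

end
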